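(* The model checking problem for $\mathsf{FPL}^{\Rightarrow}_1$ is $\mathsf{P}$-hard (under logspace many-one reductions).
   Context: Intuitionistic formulas: $\varphi ::= \bot \mid p \mid \varphi\wedge\varphi \mid \varphi\vee\varphi \mid \varphi\Rightarrow\varphi$. A model for $\mathsf{FPL}$ is $(U,\triangleleft,\xi)$ with $U$ finite nonempty, $\triangleleft$ transitive and irreflexive, $\xi$ monotone ($a\in\xi(p)$, $a\triangleleft b$ imply $b\in\xi(p)$). Satisfaction: $s\not\models\bot$; $s\models p$ iff $s\in\xi(p)$; $\wedge,\vee$ pointwise; $s\models\varphi\Rightarrow\psi$ iff for all $n$ with $s\triangleleft n$, $n\models\varphi$ implies $n\models\psi$. $\mathsf{FPL}^{\Rightarrow}_1$ denotes implicational formulas (only $\bot$, variables, $\Rightarrow$) containing at most one distinct variable. The model checking problem: given such a formula $\varphi$, a finite $\mathsf{FPL}$ model $\mathfrak{M}$ and a state $s$, decide whether $\mathfrak{M},s\models\varphi$. *)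

theory Defs
  imports Complex_Main "HOL-Library.Landau_Symbols"
begin

section \<open>Intuitionistic formulas and models for FPL\<close>

datatype fm = Bot | Var nat | And fm fm | Or fm fm | Imp fm fm

primrec vars :: "fm \<Rightarrow> nat set" where
  "vars Bot = {}"
| "vars (Var p) = {p}"
| "vars (And a b) = vars a \<union> vars b"
| "vars (Or a b) = vars a \<union> vars b"
| "vars (Imp a b) = vars a \<union> vars b"

primrec implicational :: "fm \<Rightarrow> bool" where
  "implicational Bot = True"
| "implicational (Var p) = True"
| "implicational (And a b) = False"
| "implicational (Or a b) = False"
| "implicational (Imp a b) = (implicational a \<and> implicational b)"

definition FPL_Imp1 :: "fm set" where
  "FPL_Imp1 = {\<phi>. implicational \<phi> \<and> card (vars \<phi>) \<le> 1}"

record 's model =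
  states :: "'s set"
  rel :: "('s \<times> 's) set"
  val :: "nat \<Rightarrow> 's set"

definition fpl_model :: "('s, 'm) model_scheme \<Rightarrow> bool" where
  "fpl_model M \<longleftrightarrow>
     finite (states M) \<and> states M \<noteq> {} \<and>
     rel M \<subseteq> states M \<times> states M \<and> trans (rel M) \<and> irrefl (rel M) \<and>
     (\<forall>p. val M p \<subseteq> states M) \<and>
     (\<forall>p a b. a \<in> val M p \<longrightarrow> (a, b) \<in> rel M \<longrightarrow> b \<in> val M p)"

primrec sat :: "('s, 'm) model_scheme \<Rightarrow> 's \<Rightarrow> fm \<Rightarrow> bool" where
  "sat M s Bot \<longleftrightarrow> False"
| "sat M s (Var p) \<longleftrightarrow> s \<in> val M p"
| "sat M s (And a b) \<longleftrightarrow> sat M s a \<and> sat M s b"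
| "sat M s (Or a b) \<longleftrightarrow> sat M s a \<or> sat M s b"
| "sat M s (Imp a b) \<longleftrightarrow> (\<forall>n. (s, n) \<in> rel M \<longrightarrow> sat M n a \<longrightarrow> sat M n b)"


section \<open>The model checking problem as a language of bit strings\<close>

definition unary :: "nat \<Rightarrow> bool list" where
  "unary n = replicate n True @ [False]"

text \<open>Formulas are written as trees, in prefix notation; common subformulas are not shared.\<close>

primrec enc_fm :: "fm \<Rightarrow> bool list" where
  "enc_fm Bot = [False, False, False]"
| "enc_fm (Var p) = [False, False, True] @ unary p"
| "enc_fm (And a b) = [False, True, False] @ enc_fm a @ enc_fm b"
| "enc_fm (Or a b) = [False, True, True] @ enc_fm a @ enc_fm b"
| "enc_fm (Imp a b) = [True, False, False] @ enc_fm a @ enc_fm b"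

text \<open>
  An instance is coded for models whose states are the numbers below \<open>n\<close>: the formula, \<open>n\<close>
  in unary, the adjacency matrix row by row, one characteristic vector for each variable that
  occurs in the formula (the other variables do not affect satisfaction), and the state in unary.
\<close>

definition enc_instance :: "fm \<Rightarrow> nat model \<Rightarrow> nat \<Rightarrow> bool list" where
  "enc_instance \<phi> M s =
     (let n = card (states M) in
       enc_fm \<phi> @ unary n @
       concat (map (\<lambda>i. map (\<lambda>j. (i, j) \<in> rel M) [0..<n]) [0..<n]) @
       concat (map (\<lambda>p. map (\<lambda>i. i \<in> val M p) [0..<n]) (sorted_list_of_set (vars \<phi>))) @
       unary s)"

definition fpl_instance :: "fm \<Rightarrow> nat model \<Rightarrow> nat \<Rightarrow> bool" where
  "fpl_instance \<phi> M s \<longleftrightarrow> fpl_model M \<and> (\<exists>n. states M = {..<n}) \<and> s \<in> states M"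

definition model_checking :: "fm set \<Rightarrow> bool list set" where
  "model_checking F =
     {enc_instance \<phi> M s | \<phi> M s. \<phi> \<in> F \<and> fpl_instance \<phi> M s \<and> sat M s \<phi>}"


subsection \<open>The encoding is unambiguous\<close>

lemma finite_vars [simp]: "finite (vars \<phi>)"
  by (induction \<phi>) auto

lemma unary_append_inject: "unary m @ x = unary n @ y \<longleftrightarrow> m = n \<and> x = y"
proof (induction m arbitrary: n)
  case 0
  show ?case by (cases n) (auto simp: unary_def)
next
  case (Suc m)
  then show ?case by (cases n) (auto simp: unary_def)
qed

lemma enc_fm_append_inject: "enc_fm a @ x = enc_fm b @ y \<longleftrightarrow> a = b \<and> x = y"
proof (induction a arbitrary: b x y)
  case Bot
  show ?case by (cases b) auto
next
  case (Var p)
  show ?case by (cases b) (auto simp: unary_append_inject)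
next
  case (And a1 a2)
  then show ?case by (cases b) auto
next
  case (Or a1 a2)
  then show ?case by (cases b) auto
next
  case (Imp a1 a2)
  then show ?case by (cases b) auto
qed

lemma length_concat_rows:
  "length (concat (map (\<lambda>i. map (f i) [0..<n]) xs)) = length xs * n"
  by (induction xs) auto

lemma concat_rows_inject:
  "concat (map (\<lambda>i. map (f i) [0..<n]) xs) = concat (map (\<lambda>i. map (g i) [0..<n]) xs)
   \<longleftrightarrow> (\<forall>i\<in>set xs. \<forall>j<n. f i j = g i j)"
  by (induction xs) auto

lemma enc_instance_inject:
  assumes "fpl_instance \<phi> M s" "fpl_instance \<psi> N t"
    and eq: "enc_instance \<phi> M s = enc_instance \<psi> N t"
  shows "\<phi> = \<psi>" "states M = states N" "rel M = rel N" "\<forall>p\<in>vars \<phi>. val M p = val N p" "s = t"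
proof -
  obtain m n where m: "states M = {..<m}" and n: "states N = {..<n}"
    using assms(1,2) unfolding fpl_instance_def by blast
  let ?rows = "\<lambda>K k. concat (map (\<lambda>i. map (\<lambda>j. (i, j) \<in> rel K) [0..<k]) [0..<k])"
  let ?vals = "\<lambda>K k \<chi>. concat (map (\<lambda>p. map (\<lambda>i. i \<in> val K p) [0..<k])
                                         (sorted_list_of_set (vars \<chi>)))"
  have e: "enc_fm \<phi> @ unary m @ ?rows M m @ ?vals M m \<phi> @ unary s =
           enc_fm \<psi> @ unary n @ ?rows N n @ ?vals N n \<psi> @ unary t"
    using eq by (simp only: enc_instance_def Let_def m n card_lessThan)
  then show 1: "\<phi> = \<psi>" by (simp only: enc_fm_append_inject)
  from e have mn: "m = n" by (simp only: enc_fm_append_inject unary_append_inject)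
  then show "states M = states N" by (simp only: m n)
  from e have e2: "?rows M n @ ?vals M n \<phi> @ unary s = ?rows N n @ ?vals N n \<phi> @ unary t"
    unfolding 1 mn by (simp only: same_append_eq)
  have len: "length (?rows M n) = length (?rows N n)" "length (?vals M n \<phi>) = length (?vals N n \<phi>)"
    by (simp_all only: length_concat_rows)
  have "?rows M n = ?rows N n \<and> ?vals M n \<phi> = ?vals N n \<phi> \<and> unary s = unary t"
    using e2 unfolding append_eq_append_conv[OF disjI1, OF len(1)]
      append_eq_append_conv[OF disjI1, OF len(2)]
    .
  then have e3: "?rows M n = ?rows N n" "?vals M n \<phi> = ?vals N n \<phi>" "unary s = unary t"
    by (simp_all only:)
  from e3(3) show "s = t" using unary_append_inject[of s "[]" t "[]"] by simp
  have r: "\<forall>i<n. \<forall>j<n. (i, j) \<in> rel M \<longleftrightarrow> (i, j) \<in> rel N"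
    using e3(1)[unfolded concat_rows_inject] by simp
  have v: "\<forall>p\<in>vars \<phi>. \<forall>i<n. i \<in> val M p \<longleftrightarrow> i \<in> val N p"
    using e3(2)[unfolded concat_rows_inject] by simp
  have sub: "rel M \<subseteq> {..<n} \<times> {..<n}" "rel N \<subseteq> {..<n} \<times> {..<n}"
    "val M p \<subseteq> {..<n}" "val N p \<subseteq> {..<n}" for p
    using assms(1,2) m n mn unfolding fpl_instance_def fpl_model_def by simp_all
  show "rel M = rel N"
  proof (rule set_eqI)
    fix z
    show "z \<in> rel M \<longleftrightarrow> z \<in> rel N"
      using r sub(1,2) by (cases z) (metis SigmaE2 lessThan_iff subsetD)
  qed
  show "\<forall>p\<in>vars \<phi>. val M p = val N p"
    using v sub(3,4) by (metis lessThan_iff subsetD subset_antisym subsetI)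
qed

lemma sat_cong:
  assumes "rel M = rel N" "\<forall>p\<in>vars \<phi>. val M p = val N p"
  shows "sat M s \<phi> \<longleftrightarrow> sat N s \<phi>"
  using assms by (induction \<phi> arbitrary: s) auto

theorem enc_instance_in_model_checking_iff:
  assumes "fpl_instance \<phi> M s" "\<phi> \<in> F"
  shows "enc_instance \<phi> M s \<in> model_checking F \<longleftrightarrow> sat M s \<phi>"
proof
  assume "enc_instance \<phi> M s \<in> model_checking F"
  then obtain \<psi> N t where *: "fpl_instance \<psi> N t" "sat N t \<psi>"
    "enc_instance \<phi> M s = enc_instance \<psi> N t"
    unfolding model_checking_def by blast
  from enc_instance_inject[OF assms(1) *(1) *(3)] *(2) sat_cong[of M N \<phi> s]
  show "sat M s \<phi>" by simp
qed (use assms in \<open>auto simp: model_checking_def\<close>)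


section \<open>Turing machines and the class P\<close>

datatype move = Lft | Stay | Rgt

text \<open>Tapes are infinite to the right only; a left move on cell \<open>0\<close> has no effect.\<close>

fun apply_move :: "move \<Rightarrow> nat \<Rightarrow> nat" where
  "apply_move Lft h = h - 1"
| "apply_move Stay h = h"
| "apply_move Rgt h = Suc h"

text \<open>
  Deterministic machines with one read-write tape. The states are the numbers below
  \<open>tm_states\<close>, the tape symbols the numbers below \<open>tm_symbols\<close>. Symbol \<open>0\<close> is the blank, and
  \<open>1\<close> and \<open>2\<close> are the input bits.
\<close>

record tm =
  tm_states :: nat
  tm_symbols :: nat
  tm_start :: nat
  tm_accept :: nat
  tm_reject :: nat
  tm_delta :: "nat \<Rightarrow> nat \<Rightarrow> nat \<times> nat \<times> move"

definition wf_tm :: "tm \<Rightarrow> bool" where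
  "wf_tm M \<longleftrightarrow>
     3 \<le> tm_symbols M \<and> tm_start M < tm_states M \<and>
     tm_accept M < tm_states M \<and> tm_reject M < tm_states M \<and> tm_accept M \<noteq> tm_reject M \<and>
     (\<forall>q < tm_states M. \<forall>a < tm_symbols M.
        case tm_delta M q a of (q', b, d) \<Rightarrow> q' < tm_states M \<and> b < tm_symbols M)"

record tm_config =
  c_state :: nat
  c_head :: nat
  c_tape :: "nat \<Rightarrow> nat"

definition bit_symbol :: "bool \<Rightarrow> nat" where
  "bit_symbol b = (if b then 2 else 1)"

definition tm_init :: "tm \<Rightarrow> bool list \<Rightarrow> tm_config" where
  "tm_init M x =
     \<lparr>c_state = tm_start M, c_head = 0,
      c_tape = (\<lambda>i. if i < length x then bit_symbol (x ! i) else 0)\<rparr>"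

definition tm_step :: "tm \<Rightarrow> tm_config \<Rightarrow> tm_config" where
  "tm_step M c =
     (if c_state c = tm_accept M \<or> c_state c = tm_reject M then c
      else case tm_delta M (c_state c) (c_tape c (c_head c)) of (q, b, d) \<Rightarrow>
        \<lparr>c_state = q, c_head = apply_move d (c_head c),
         c_tape = (c_tape c)(c_head c := b)\<rparr>)"

definition decides_in_time :: "tm \<Rightarrow> bool list set \<Rightarrow> (nat \<Rightarrow> nat) \<Rightarrow> bool" where
  "decides_in_time M L t \<longleftrightarrow>
     (\<forall>x. c_state ((tm_step M ^^ t (length x)) (tm_init M x)) =
            (if x \<in> L then tm_accept M else tm_reject M))"

definition class_P :: "bool list set set" where
  "class_P = {L. \<exists>M t k. wf_tm M \<and> decides_in_time M L t \<and>
                        (\<lambda>n. real (t n)) \<in> O(\<lambda>n. real n ^ k)}"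


section \<open>Logspace reductions\<close>

text \<open>
  Deterministic transducers with a two-way read-only input tape, \<open>tr_tapes\<close> many read-write work
  tapes and a one-way write-only output tape. The input is delimited by end markers, which the
  input head cannot cross. A step optionally appends one bit to the output. Only the work tapes
  count towards the space used.
\<close>

datatype input_symbol = Left_End | Right_End | Bit bool

record transducer =
  tr_tapes :: nat
  tr_states :: nat
  tr_symbols :: nat
  tr_start :: nat
  tr_halt :: nat
  tr_delta :: "nat \<Rightarrow> input_symbol \<Rightarrow> nat list \<Rightarrow>
                 nat \<times> move \<times> (nat \<times> move) list \<times> bool option"

definition wf_transducer :: "transducer \<Rightarrow> bool" where
  "wf_transducer T \<longleftrightarrow>
     0 < tr_symbols T \<and> tr_start T < tr_states T \<and> tr_halt T < tr_states T \<and>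
     (\<forall>q < tr_states T. \<forall>i ws. length ws = tr_tapes T \<longrightarrow> set ws \<subseteq> {..<tr_symbols T} \<longrightarrow>
        (case tr_delta T q i ws of (q', d, acts, out) \<Rightarrow>
           q' < tr_states T \<and> length acts = tr_tapes T \<and> fst ` set acts \<subseteq> {..<tr_symbols T}))"

text \<open>A work tape is a pair of a head position and the tape contents.\<close>

record tr_config =
  t_state :: nat
  t_head :: nat
  t_work :: "(nat \<times> (nat \<Rightarrow> nat)) list"
  t_output :: "bool list"

definition input_at :: "bool list \<Rightarrow> nat \<Rightarrow> input_symbol" where
  "input_at x h =
     (if h = 0 then Left_End else if h \<le> length x then Bit (x ! (h - 1)) else Right_End)"

definition tr_init :: "transducer \<Rightarrow> tr_config" where
  "tr_init T =
     \<lparr>t_state = tr_start T, t_head = 0,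
      t_work = replicate (tr_tapes T) (0, \<lambda>_. 0), t_output = []\<rparr>"

definition work_step :: "nat \<times> (nat \<Rightarrow> nat) \<Rightarrow> nat \<times> move \<Rightarrow> nat \<times> (nat \<Rightarrow> nat)" where
  "work_step w act = (apply_move (snd act) (fst w), (snd w)(fst w := fst act))"

definition tr_step :: "transducer \<Rightarrow> bool list \<Rightarrow> tr_config \<Rightarrow> tr_config" where
  "tr_step T x c =
     (if t_state c = tr_halt T then c
      else case tr_delta T (t_state c) (input_at x (t_head c)) (map (\<lambda>(h, w). w h) (t_work c))
        of (q, d, acts, out) \<Rightarrow>
        \<lparr>t_state = q,
         t_head = min (apply_move d (t_head c)) (Suc (length x)),
         t_work = map2 work_step (t_work c) acts,
         t_output = t_output c @ (case out of None \<Rightarrow> [] | Some b \<Rightarrow> [b])\<rparr>)"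

definition tr_run :: "transducer \<Rightarrow> bool list \<Rightarrow> nat \<Rightarrow> tr_config" where
  "tr_run T x i = (tr_step T x ^^ i) (tr_init T)"

definition computes :: "transducer \<Rightarrow> (bool list \<Rightarrow> bool list) \<Rightarrow> bool" where
  "computes T f \<longleftrightarrow>
     (\<forall>x. \<exists>i. t_state (tr_run T x i) = tr_halt T \<and> t_output (tr_run T x i) = f x)"

definition runs_in_space :: "transducer \<Rightarrow> (nat \<Rightarrow> nat) \<Rightarrow> bool" where
  "runs_in_space T s \<longleftrightarrow>
     (\<forall>x i. \<forall>w \<in> set (t_work (tr_run T x i)). fst w < s (length x))"

definition logspace_computable :: "(bool list \<Rightarrow> bool list) \<Rightarrow> bool" where
  "logspace_computable f \<longleftrightarrow>
     (\<exists>T s. wf_transducer T \<and> computes T f \<and> runs_in_space T s \<and>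
            (\<lambda>n. real (s n)) \<in> O(\<lambda>n. ln (real n)))"

definition logspace_reducible :: "bool list set \<Rightarrow> bool list set \<Rightarrow> bool"
    (infix \<open>\<le>\<^sub>l\<^sub>o\<^sub>g\<close> 50) where
  "A \<le>\<^sub>l\<^sub>o\<^sub>g B \<longleftrightarrow> (\<exists>f. logspace_computable f \<and> (\<forall>x. x \<in> A \<longleftrightarrow> f x \<in> B))"

definition P_hard :: "bool list set \<Rightarrow> bool" where
  "P_hard B \<longleftrightarrow> (\<forall>A \<in> class_P. A \<le>\<^sub>l\<^sub>o\<^sub>g B)"

end

(*
  A Turing machine is unrolled into a network of NOR gates with layers Y and Z alternating: the gate
  Y s at (t, i) says that cell i does not contain s at time t, and the gate Z a b c says that the
  cells i - 1, i, i + 1 contain a, b, c. Both kinds are NORs of local gates of the previous layer.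
  A network of height H becomes a model with one state per gate, in which a state sees its inputs
  in the next level and all states further down. Since the height of a state is its distance to the
  bottom level, rank_fm k (the k-fold box of falsum) holds exactly at height less than k, and
  nor_fm (k + 1) = (nor_fm k => rank_fm k) says at height k + 1 that all inputs violate nor_fm k:
  implication computes a NOR. The variable only supplies the values of the bottom level.

  The reduction is computed by a program with polynomially bounded counters, whose control is
  compiled into the states of a transducer that keeps the counters in binary on its work tapes.
*)

theory Submission
  imports Defs "HOL-Real_Asymp.Real_Asymp"
begin

section \<open>Counter programs and logarithmic space\<close>

text \<open>Formulas are coded as trees, so unfolding a circuit with shared gates into the formula
  could blow it up. Hence the wiring goes into the relation, and the formula depends on the height
  alone. As \<open>nor_fm\<close> contains its predecessor once, next to a conclusion of linear
  size, its code is quadratic in the height. The obstacle is transitivity, by which a gate sees the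
  inputs of its inputs. Letting it see everything further down costs nothing, because the conclusion
  \<open>rank_fm k\<close> is true there. This needs exact heights, so each gate above the bottom
  must have an input in the next level. Monotonicity is no issue: the variable holds only at states
  without successors. The layers \<open>Y\<close> carry negated information, so satisfaction at the
  output expresses the absence of a symbol. Therefore rejection, not acceptance, is signalled, and
  it travels to cell \<open>0\<close> so that one fixed state can be queried. All gates stand at
  every position of every level; those of the wrong parity are never consulted by the relevant ones.
  By this uniformity each row of the adjacency matrix is piecewise constant outside at most three
  blocks, and a few counters suffice to write it.\<close>

text \<open>
  \<open>Cond v a b\<close> and \<open>While v b\<close> decrement the counter \<open>v\<close> whenever they find it positive. In
  \<open>exec x B\<close> no counter ever exceeds \<open>B\<close>.
\<close>

datatype com =
    Skip
  | Out "input_symbol \<Rightarrow> bool"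
  | Move move
  | Inc nat
  | Seq com com
  | Cond nat com com
  | While nat com
  | WhileIn "input_symbol \<Rightarrow> bool" com

inductive exec :: "bool list \<Rightarrow> nat \<Rightarrow> com \<Rightarrow> nat list \<times> nat \<Rightarrow> bool list \<Rightarrow> nat list \<times> nat \<Rightarrow> bool"
  for x :: "bool list" and B :: nat where
  Skip: "exec x B Skip s [] s"
| Out: "exec x B (Out f) (C, h) [f (input_at x h)] (C, h)"
| Move: "exec x B (Move d) (C, h) [] (C, min (apply_move d h) (Suc (length x)))"
| Inc: "v < length C \<Longrightarrow> C ! v < B \<Longrightarrow> exec x B (Inc v) (C, h) [] (C[v := Suc (C ! v)], h)"
| Seq: "exec x B a s os s' \<Longrightarrow> exec x B b s' os' s'' \<Longrightarrow> exec x B (Seq a b) s (os @ os') s''"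
| Cond_0: "v < length C \<Longrightarrow> C ! v = 0 \<Longrightarrow> exec x B b (C, h) os s' \<Longrightarrow> exec x B (Cond v a b) (C, h) os s'"
| Cond_Suc: "v < length C \<Longrightarrow> C ! v = Suc n \<Longrightarrow> exec x B a (C[v := n], h) os s' \<Longrightarrow>
    exec x B (Cond v a b) (C, h) os s'"
| While_0: "v < length C \<Longrightarrow> C ! v = 0 \<Longrightarrow> exec x B (While v b) (C, h) [] (C, h)"
| While_Suc: "v < length C \<Longrightarrow> C ! v = Suc n \<Longrightarrow> exec x B b (C[v := n], h) os s' \<Longrightarrow>
    exec x B (While v b) s' os' s'' \<Longrightarrow> exec x B (While v b) (C, h) (os @ os') s''"
| WhileIn_stop: "\<not> f (input_at x h) \<Longrightarrow> exec x B (WhileIn f b) (C, h) [] (C, h)"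
| WhileIn_step: "f (input_at x h) \<Longrightarrow> exec x B b (C, h) os s' \<Longrightarrow>
    exec x B (WhileIn f b) s' os' s'' \<Longrightarrow> exec x B (WhileIn f b) (C, h) (os @ os') s''"

subsection \<open>Binary counters on a tape\<close>

fun bval :: "bool list \<Rightarrow> nat" where
  "bval [] = 0"
| "bval (b # bs) = of_bool b + 2 * bval bs"

fun incr :: "bool list \<Rightarrow> bool list" where
  "incr [] = [True]"
| "incr (False # bs) = True # bs"
| "incr (True # bs) = False # incr bs"

fun decr :: "bool list \<Rightarrow> bool list" where
  "decr [] = []"
| "decr (True # bs) = False # bs"
| "decr (False # bs) = True # decr bs"

lemma bval_incr [simp]: "bval (incr bs) = Suc (bval bs)"
  by (induction bs rule: incr.induct) auto

lemma bval_decr: "bval bs > 0 \<Longrightarrow> bval (decr bs) = bval bs - 1"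
  by (induction bs rule: decr.induct) auto

lemma length_decr [simp]: "length (decr bs) = length bs"
  by (induction bs rule: decr.induct) auto

text \<open>A new digit appears only on overflow, when the new value is a power of two. Thus every
  digit is paid for by a value that the counter has reached.\<close>

lemma length_incr:
  "length (incr bs) = length bs \<or> length (incr bs) = Suc (length bs) \<and> bval (incr bs) = 2 ^ length bs"
  by (induction bs rule: incr.induct) auto

lemma bval_0: "bval bs = 0 \<Longrightarrow> bs = replicate (length bs) False"
  by (induction bs) auto

text \<open>
  The least significant digit is stored in cell \<open>0\<close>, with the symbols \<open>3\<close> and \<open>4\<close> instead of
  \<open>1\<close> and \<open>2\<close>, so that the head recognises the left end of the tape.
\<close>

definition cells :: "bool list \<Rightarrow> nat \<Rightarrow> nat" where
  "cells bs i = (if i < length bs then (if i = 0 then 3 else 1) + of_bool (bs ! i) else 0)"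

text \<open>
  \<open>Carry\<close> propagates a carry or a borrow to the right and \<open>Back\<close> returns to cell \<open>0\<close>. A borrow that
  runs off the end of the number has met the counter \<open>0\<close>, and \<open>Undo\<close> restores it.
\<close>

datatype phase = Ready | Carry | Back | Undo

text \<open>The first argument selects increment or decrement. The Boolean at the end reports
  whether a decrement met a positive number, so testing for zero and decrementing are one
  operation.\<close>

fun tape_act :: "bool \<Rightarrow> phase \<Rightarrow> nat \<Rightarrow> (phase + bool) \<times> nat \<times> move" where
  "tape_act True Ready w = (if w = 4 then (Inl Carry, 3, Rgt) else (Inr True, 4, Stay))"
| "tape_act True Carry w = (if w = 2 then (Inl Carry, 1, Rgt) else (Inl Back, 2, Lft))"
| "tape_act False Ready w =
     (if w = 0 then (Inr False, 0, Stay) else if w = 4 then (Inr True, 3, Stay) else (Inl Carry, 4, Rgt))"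
| "tape_act False Carry w =
     (if w = 0 then (Inl Undo, 0, Lft) else if w = 2 then (Inl Back, 1, Lft) else (Inl Carry, 2, Rgt))"
| "tape_act _ Back w = (if w \<ge> 3 then (Inr True, w, Stay) else (Inl Back, w, Lft))"
| "tape_act _ Undo w = (if w \<ge> 3 then (Inr False, 3, Stay) else (Inl Undo, 1, Lft))"

inductive tape_run :: "bool \<Rightarrow> nat \<Rightarrow> phase \<Rightarrow> nat \<times> (nat \<Rightarrow> nat) \<Rightarrow> bool \<Rightarrow> nat \<times> (nat \<Rightarrow> nat) \<Rightarrow> bool"
  for inc :: bool and N :: nat where
  stop: "tape_act inc ph (w h) = (Inr b, act) \<Longrightarrow> h \<le> N \<Longrightarrow> work_step (h, w) act = t' \<Longrightarrow>
    tape_run inc N ph (h, w) b t'"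
| step: "tape_act inc ph (w h) = (Inl ph', act) \<Longrightarrow> h \<le> N \<Longrightarrow> tape_run inc N ph' (work_step (h, w) act) b t' \<Longrightarrow>
    tape_run inc N ph (h, w) b t'"

lemma cells_upd_end: "bs \<noteq> [] \<Longrightarrow> (cells bs)(length bs := if b then 2 else 1) = cells (bs @ [b])"
  by (auto simp: cells_def fun_eq_iff nth_append)

lemma cells_upd:
  "pre \<noteq> [] \<Longrightarrow> (cells (pre @ a # bs))(length pre := if b then 2 else 1) = cells (pre @ b # bs)"
  by (auto simp: cells_def fun_eq_iff nth_append nth_Cons')

lemma cells_upd_0: "(cells (a # bs))(0 := if b then 4 else 3) = cells (b # bs)"
  by (auto simp: cells_def fun_eq_iff nth_Cons')

lemma cells_upd_same: "w = cells bs i \<Longrightarrow> (cells bs)(i := w) = cells bs"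
  by auto

lemma cells_at: "cells (pre @ a # bs) (length pre) = (if pre = [] then 3 else 1) + of_bool a"
  by (auto simp: cells_def)

lemma cells_at_end: "cells bs (length bs) = 0"
  by (auto simp: cells_def)

lemma tape_run_Back:
  assumes "j < length bs" "length bs \<le> N"
  shows "tape_run inc N Back (j, cells bs) True (0, cells bs)"
  using assms(1)
proof (induction j)
  case 0
  show ?case
    by (rule stop[where act = "(cells bs 0, Stay)"])
      (cases inc; use 0 in \<open>auto simp: cells_def work_step_def\<close>)+
next
  case (Suc j)
  have "cells bs (Suc j) < 3" by (simp add: cells_def)
  then have "tape_act inc Back (cells bs (Suc j)) = (Inl Back, cells bs (Suc j), Lft)"
    by (cases inc) auto
  then show ?case
    by (rule step) (use Suc assms(2) in \<open>auto simp: work_step_def\<close>)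
qed

text \<open>A borrow that ran off the end has turned all zeros into ones. The invariant is that the
  digits right of the head are zeros again.\<close>

lemma tape_run_Undo:
  assumes "Suc j + m \<le> N"
  shows "tape_run False N Undo (j, cells (replicate (Suc j) True @ replicate m False)) False
    (0, cells (replicate (Suc j + m) False))"
  using assms
proof (induction j arbitrary: m)
  case 0
  show ?case
    by (rule stop[where act = "(3, Stay)"])
      (use 0 cells_upd_0[of True "replicate m False" False] in \<open>auto simp: cells_def work_step_def\<close>)
next
  case (Suc j)
  have eq: "(cells (replicate (Suc (Suc j)) True @ replicate m False))(Suc j := 1) =
      cells (replicate (Suc j) True @ replicate (Suc m) False)"
    using cells_upd[of "replicate (Suc j) True" True "replicate m False" False]
    by (simp add: replicate_app_Cons_same)
  show ?case
    by (rule step[where act = "(1, Lft)" and ph' = Undo])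
      (use Suc.IH[of "Suc m"] Suc.prems eq in \<open>auto simp: cells_def[of _ "Suc j"] work_step_def nth_append\<close>)
qed

text \<open>Generalised over the prefix that the carry has passed. It is nonempty because cell
  \<open>0\<close> has its own digit symbols and is handled in phase \<open>Ready\<close>.\<close>

lemma tape_run_Carry_incr:
  assumes "pre \<noteq> []" "length (pre @ incr bs) \<le> N"
  shows "tape_run True N Carry (length pre, cells (pre @ bs)) True (0, cells (pre @ incr bs))"
  using assms
proof (induction bs arbitrary: pre rule: incr.induct)
  case 1
  show ?case
    by (rule step[where act = "(2, Lft)" and ph' = Back])
      (use 1 cells_upd_end[of pre True] tape_run_Back[of "length pre - 1" "pre @ [True]" N True]
        in \<open>auto simp: cells_at_end work_step_def\<close>)
next
  case (2 bs)
  show ?case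
    by (rule step[where act = "(2, Lft)" and ph' = Back])
      (use 2 cells_upd[of pre False bs True] tape_run_Back[of "length pre - 1" "pre @ True # bs" N True]
        in \<open>auto simp: cells_at work_step_def\<close>)
next
  case (3 bs)
  show ?case
    by (rule step[where act = "(1, Rgt)" and ph' = Carry])
      (use 3(1)[of "pre @ [False]"] 3(2,3) cells_upd[of pre True bs False]
        in \<open>auto simp: cells_at work_step_def\<close>)
qed

lemma tape_run_incr:
  assumes "length (incr bs) \<le> N"
  shows "tape_run True N Ready (0, cells bs) True (0, cells (incr bs))"
proof (cases bs rule: incr.cases)
  case 1
  show ?thesis
    by (rule stop[where act = "(4, Stay)"]) (use 1 in \<open>auto simp: cells_def work_step_def fun_eq_iff\<close>)
next
  case (2 cs)
  show ?thesis
    by (rule stop[where act = "(4, Stay)"])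
      (use 2 cells_upd_0[of False cs True] in \<open>auto simp: cells_def[of _ 0] work_step_def\<close>)
next
  case (3 cs)
  show ?thesis
    by (rule step[where act = "(3, Rgt)" and ph' = Carry])
      (use 3 assms cells_upd_0[of True cs False] tape_run_Carry_incr[of "[False]" cs N]
        in \<open>auto simp: cells_def[of _ 0] work_step_def\<close>)
qed

lemma tape_run_Carry_decr:
  assumes "pre \<noteq> []" "length (pre @ bs) \<le> N" "bval bs > 0"
  shows "tape_run False N Carry (length pre, cells (pre @ bs)) True (0, cells (pre @ decr bs))"
  using assms
proof (induction bs arbitrary: pre rule: decr.induct)
  case 1
  then show ?case by simp
next
  case (2 bs)
  show ?case
    by (rule step[where act = "(1, Lft)" and ph' = Back])
      (use 2 cells_upd[of pre True bs False] tape_run_Back[of "length pre - 1" "pre @ False # bs" N False]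
        in \<open>auto simp: cells_at work_step_def\<close>)
next
  case (3 bs)
  show ?case
    by (rule step[where act = "(2, Rgt)" and ph' = Carry])
      (use 3(1)[of "pre @ [True]"] 3(2-) cells_upd[of pre False bs True]
        in \<open>auto simp: cells_at work_step_def\<close>)
qed

lemma tape_run_decr:
  assumes "length bs \<le> N" "bval bs > 0"
  shows "tape_run False N Ready (0, cells bs) True (0, cells (decr bs))"
proof (cases bs rule: decr.cases)
  case 1
  then show ?thesis using assms by simp
next
  case (2 cs)
  show ?thesis
    by (rule stop[where act = "(3, Stay)"])
      (use 2 cells_upd_0[of True cs False] in \<open>auto simp: cells_def[of _ 0] work_step_def\<close>)
next
  case (3 cs)
  show ?thesis
    by (rule step[where act = "(4, Rgt)" and ph' = Carry])
      (use 3 assms cells_upd_0[of False cs True] tape_run_Carry_decr[of "[True]" cs N]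
        in \<open>auto simp: cells_def[of _ 0] work_step_def\<close>)
qed

lemma tape_run_Carry_zero:
  assumes "Suc j + m \<le> N"
  shows "tape_run False N Carry (Suc j, cells (replicate (Suc j) True @ replicate m False)) False
    (0, cells (replicate (Suc j + m) False))"
  using assms
proof (induction m arbitrary: j)
  case 0
  show ?case
    by (rule step[where act = "(0, Lft)" and ph' = Undo])
      (use 0 tape_run_Undo[of j 0 N] cells_at_end[of "replicate (Suc j) True"] in \<open>auto simp: work_step_def
        cells_upd_same\<close>)
next
  case (Suc m)
  have eq: "(cells (replicate (Suc j) True @ replicate (Suc m) False))(Suc j := 2) =
      cells (replicate (Suc (Suc j)) True @ replicate m False)"
    using cells_upd[of "replicate (Suc j) True" False "replicate m False" True]
    by (simp add: replicate_app_Cons_same)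
  show ?case
    by (rule step[where act = "(2, Rgt)" and ph' = Carry])
      (use Suc.IH[of "Suc j"] Suc.prems eq in \<open>auto simp: cells_def[of _ "Suc j"] work_step_def nth_append\<close>)
qed

lemma tape_run_zero:
  assumes "length bs \<le> N" "bval bs = 0"
  shows "tape_run False N Ready (0, cells bs) False (0, cells bs)"
proof (cases "length bs")
  case 0
  show ?thesis
    by (rule stop[where act = "(0, Stay)"]) (use 0 in \<open>auto simp: cells_def work_step_def\<close>)
next
  case (Suc m)
  then have bs: "bs = False # replicate m False"
    using bval_0[OF assms(2)] by simp
  show ?thesis
    by (rule step[where act = "(4, Rgt)" and ph' = Carry])
      (use bs assms cells_upd_0[of False "replicate m False" True] tape_run_Carry_zero[of 0 m N]
        in \<open>auto simp: cells_def[of _ 0] work_step_def\<close>)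
qed

text \<open>The length is bounded through the capacity \<open>B\<close> and not through the value,
  because \<open>decr\<close> keeps zeros in the most significant places. The factor 2 admits the
  digits of \<open>B\<close> itself.\<close>

definition represents :: "nat \<Rightarrow> nat \<Rightarrow> nat \<times> (nat \<Rightarrow> nat) \<Rightarrow> bool" where
  "represents B v t \<longleftrightarrow> (\<exists>bs. t = (0, cells bs) \<and> bval bs = v \<and> 2 ^ length bs \<le> 2 * B)"

context
  fixes B N :: nat
  assumes N: "\<And>l. 2 ^ l \<le> 2 * B \<Longrightarrow> l \<le> N"
begin

lemma represents_incr:
  assumes "represents B v t" "v < B"
  obtains t' where "tape_run True N Ready t True t'" "represents B (Suc v) t'"
proof -
  obtain bs where bs: "t = (0, cells bs)" "bval bs = v" "2 ^ length bs \<le> 2 * B"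
    using assms(1) by (auto simp: represents_def)
  have le: "2 ^ length (incr bs) \<le> 2 * B"
    using length_incr[of bs] bs assms(2) by auto
  show ?thesis
    by (rule that[OF _ _])
      (use tape_run_incr[OF N[OF le]] bs le in \<open>auto simp: represents_def intro!: exI[of _ "incr bs"]\<close>)
qed

lemma represents_decr:
  assumes "represents B (Suc v) t"
  obtains t' where "tape_run False N Ready t True t'" "represents B v t'"
proof -
  obtain bs where bs: "t = (0, cells bs)" "bval bs = Suc v" "2 ^ length bs \<le> 2 * B"
    using assms(1) by (auto simp: represents_def)
  show ?thesis
    by (rule that[OF _ _])
      (use tape_run_decr[OF N[OF bs(3)]] bs in \<open>auto simp: represents_def bval_decr intro!: exI[of _ "decr bs"]\<close>)
qed

lemma represents_zero:
  assumes "represents B 0 t"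
  shows "tape_run False N Ready t False t"
  using assms tape_run_zero[OF N] by (auto simp: represents_def)

end

subsection \<open>Compilation to transducers\<close>

type_synonym control = "com list \<times> phase"

type_synonym response = "control \<times> move \<times> (nat \<times> move) list \<times> bool option"

definition keep :: "nat list \<Rightarrow> (nat \<times> move) list" where
  "keep ws = map (\<lambda>w. (w, Stay)) ws"

text \<open>The stack stays in place until the tape operation reports a result, so its top command
  remembers which counter is being changed.\<close>

definition counter_resp ::
    "bool \<Rightarrow> nat \<Rightarrow> com list \<Rightarrow> com list \<Rightarrow> control \<Rightarrow> nat list \<Rightarrow> response" where
  "counter_resp inc v k1 k0 c ws =
     (case tape_act inc (snd c) (ws ! v) of (r, act) \<Rightarrow>
       ((case r of Inl ph \<Rightarrow> (fst c, ph) | Inr b \<Rightarrow> (if b then k1 else k0, Ready)),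
        Stay, (keep ws)[v := act], None))"

fun respond :: "control \<Rightarrow> input_symbol \<Rightarrow> nat list \<Rightarrow> response" where
  "respond ([], ph) i ws = (([], Ready), Stay, keep ws, None)"
| "respond (Skip # k, ph) i ws = ((k, Ready), Stay, keep ws, None)"
| "respond (Out f # k, ph) i ws = ((k, Ready), Stay, keep ws, Some (f i))"
| "respond (Move d # k, ph) i ws = ((k, Ready), d, keep ws, None)"
| "respond (Seq a b # k, ph) i ws = ((a # b # k, Ready), Stay, keep ws, None)"
| "respond (WhileIn f b # k, ph) i ws = ((if f i then b # WhileIn f b # k else k, Ready), Stay, keep ws, None)"
| "respond (Inc v # k, ph) i ws = counter_resp True v k k (Inc v # k, ph) ws"
| "respond (Cond v a b # k, ph) i ws = counter_resp False v (a # k) (b # k) (Cond v a b # k, ph) ws"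
| "respond (While v b # k, ph) i ws = counter_resp False v (b # While v b # k) k (While v b # k, ph) ws"

fun succs :: "com list \<Rightarrow> com list set" where
  "succs [] = {}"
| "succs (Seq a b # k) = {a # b # k}"
| "succs (WhileIn f b # k) = {b # WhileIn f b # k, k}"
| "succs (Cond v a b # k) = {a # k, b # k}"
| "succs (While v b # k) = {b # While v b # k, k}"
| "succs (_ # k) = {k}"

text \<open>The stacks that can be met while \<open>c\<close> is executed on top of \<open>k\<close>.\<close>

primrec stacks :: "com \<Rightarrow> com list \<Rightarrow> com list set" where
  "stacks Skip k = {Skip # k}"
| "stacks (Out f) k = {Out f # k}"
| "stacks (Move d) k = {Move d # k}"
| "stacks (Inc v) k = {Inc v # k}"
| "stacks (Seq a b) k = {Seq a b # k} \<union> stacks a (b # k) \<union> stacks b k"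
| "stacks (Cond v a b) k = {Cond v a b # k} \<union> stacks a k \<union> stacks b k"
| "stacks (While v b) k = {While v b # k} \<union> stacks b (While v b # k)"
| "stacks (WhileIn f b) k = {WhileIn f b # k} \<union> stacks b (WhileIn f b # k)"

lemma stacks_self: "c # k \<in> stacks c k"
  by (cases c) auto

lemma finite_stacks: "finite (stacks c k)"
  by (induction c arbitrary: k) auto

text \<open>This closure makes a control with stacks finite: a loop puts back the very stack on
  which it was found, so unrolling it creates nothing new.\<close>

lemma succs_stacks: "st \<in> stacks c k \<Longrightarrow> succs st \<subseteq> insert k (stacks c k)"
proof (induction c arbitrary: k st)
  case (Seq a b)
  then show ?case using stacks_self[of a "b # k"] stacks_self[of b k] by fastforce
next
  case (Cond v a b)
  then show ?case using stacks_self[of a k] stacks_self[of b k] by fastforce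
next
  case (While v b)
  then show ?case using stacks_self[of b "While v b # k"] by fastforce
next
  case (WhileIn f b)
  then show ?case using stacks_self[of b "WhileIn f b # k"] by fastforce
qed auto

definition controls :: "com \<Rightarrow> control set" where
  "controls c = insert [] (stacks c []) \<times> {Ready, Carry, Back, Undo}"

lemma phase_cases: "ph \<in> {Ready, Carry, Back, Undo}"
  by (cases ph) auto

lemma controls_iff: "(st, ph) \<in> controls c \<longleftrightarrow> st = [] \<or> st \<in> stacks c []"
  using phase_cases[of ph] by (auto simp: controls_def)

lemma stacks_tail: "c # k \<in> stacks p k' \<Longrightarrow> k \<in> insert k' (stacks p k')"
proof (induction p arbitrary: k')
  case (Seq a b)
  then show ?case using stacks_self[of b k'] by fastforce
next
  case (While v b)
  then show ?case using stacks_self[of "While v b" k'] by fastforce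
next
  case (WhileIn f b)
  then show ?case using stacks_self[of "WhileIn f b" k'] by fastforce
qed auto

lemma controls_tail: "(c # k, ph) \<in> controls p \<Longrightarrow> (k, ph) \<in> controls p"
  using stacks_tail[of c k p "[]"] by (auto simp: controls_iff)

lemma finite_controls: "finite (controls c)"
  by (simp add: controls_def finite_stacks)

lemma controls_succs: "(st, ph) \<in> controls c \<Longrightarrow> st' \<in> succs st \<Longrightarrow> (st', ph') \<in> controls c"
  using succs_stacks[of st c "[]"] by (auto simp: controls_iff)

lemma respond_controls:
  assumes "q \<in> controls c"
  shows "fst (respond q i ws) \<in> controls c"
proof -
  have "fst (respond q i ws) = (fst q, snd (fst (respond q i ws))) \<or> fst (fst (respond q i ws)) \<in> succs (fst q)
    \<or> fst (fst (respond q i ws)) = []"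
    by (induction q i ws rule: respond.induct)
      (auto simp: counter_resp_def split: prod.splits sum.splits)
  then show ?thesis
    using assms controls_succs[of "fst q" "snd q" c]
    by (cases q; cases "fst (respond q i ws)") (auto simp: controls_iff)
qed

lemma tape_act_symbol: "tape_act inc ph w = (r, b, d) \<Longrightarrow> w < 5 \<Longrightarrow> b < 5"
  by (induction inc ph w rule: tape_act.induct) (auto split: if_splits)

lemma set_keep: "fst ` set (keep ws) = set ws"
  by (force simp: keep_def)

lemma respond_acts:
  assumes "respond q i ws = (q', d, acts, out)"
  shows "length acts = length ws \<and> (set ws \<subseteq> {..<5} \<longrightarrow> fst ` set acts \<subseteq> {..<5})"
proof -
  have ct: "fst ` set ((keep ws)[v := act]) \<subseteq> {..<5}"
    if "tape_act inc ph (ws ! v) = (r, act)" "set ws \<subseteq> {..<5}" for inc ph v r act ws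
  proof (cases "v < length ws")
    case True
    then have "ws ! v < 5" using that(2) nth_mem[of v ws] by (meson lessThan_iff subsetD)
    then have "fst act < 5" using tape_act_symbol[of inc ph "ws ! v" r "fst act" "snd act"] that by simp
    moreover have "fst ` set ((keep ws)[v := act]) \<subseteq> insert (fst act) (fst ` set (keep ws))"
      using set_update_subset_insert[of "keep ws" v act] by blast
    ultimately show ?thesis using that(2) by (auto simp: set_keep)
  next
    case False
    then have "(keep ws)[v := act] = keep ws" by (simp add: keep_def list_update_beyond)
    then show ?thesis using that(2) by (simp only: set_keep)
  qed
  have ct_elem: "e < 5"
    if "tape_act inc ph (ws ! v) = (r, act)" "(e, d) \<in> set ((keep ws)[v := act])" "set ws \<subseteq> {..<5}" for inc ph v r act ws e d
    using ct[OF that(1,3)] that(2) by force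
  have "length (fst (snd (snd (respond q i ws)))) = length ws \<and>
      (set ws \<subseteq> {..<5} \<longrightarrow> fst ` set (fst (snd (snd (respond q i ws)))) \<subseteq> {..<5})"
    by (induction q i ws rule: respond.induct)
      (auto 0 3 simp: counter_resp_def set_keep keep_def[THEN arg_cong[where f = length]] split: prod.splits
        dest: ct_elem)
  then show ?thesis by (simp add: assms)
qed

text \<open>The numbering of the controls is arbitrary and supplied from outside. The five symbols
  are the blank and the two digits in their two forms.\<close>

definition transducer_of :: "nat \<Rightarrow> com \<Rightarrow> (control \<Rightarrow> nat) \<Rightarrow> transducer" where
  "transducer_of r p code =
     \<lparr>tr_tapes = r, tr_states = card (controls p), tr_symbols = 5,
      tr_start = code ([p], Ready), tr_halt = code ([], Ready),
      tr_delta = (\<lambda>q i ws. case respond (the_inv_into (controls p) code q) i ws of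
         (q', d, acts, out) \<Rightarrow> (code q', d, acts, out))\<rparr>"

locale compiled =
  fixes r :: nat and p :: com and code :: "control \<Rightarrow> nat" and x :: "bool list" and B N :: nat
  assumes bij: "bij_betw code (controls p) {..<card (controls p)}"
    and B: "B > 0"
    and N: "\<And>l. 2 ^ l \<le> 2 * B \<Longrightarrow> l \<le> N"
begin

abbreviation "T \<equiv> transducer_of r p code"

definition conf :: "com list \<Rightarrow> phase \<Rightarrow> nat \<Rightarrow> (nat \<times> (nat \<Rightarrow> nat)) list \<Rightarrow> bool list \<Rightarrow> tr_config" where
  "conf st ph h W os = \<lparr>t_state = code (st, ph), t_head = h, t_work = W, t_output = os\<rparr>"

definition heads_ok :: "tr_config \<Rightarrow> bool" where
  "heads_ok c \<longleftrightarrow> (\<forall>w \<in> set (t_work c). fst w \<le> N)"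

text \<open>The bound on the heads is part of each step, so that a path to a halted configuration
  also bounds the space of the run.\<close>

definition reach :: "tr_config \<Rightarrow> tr_config \<Rightarrow> bool" where
  "reach = (\<lambda>c c'. heads_ok c \<and> c' = tr_step T x c)\<^sup>*\<^sup>*"

lemma reach_trans: "reach a b \<Longrightarrow> reach b c \<Longrightarrow> reach a c"
  by (auto simp: reach_def)

lemma reach_step: "heads_ok c \<Longrightarrow> reach c (tr_step T x c)"
  by (auto simp: reach_def)

lemma decode: "q \<in> controls p \<Longrightarrow> the_inv_into (controls p) code (code q) = q"
  using bij by (simp add: bij_betw_def the_inv_into_f_f)

lemma code_eq_iff: "q \<in> controls p \<Longrightarrow> q' \<in> controls p \<Longrightarrow> code q = code q' \<longleftrightarrow> q = q'"
  using bij by (auto simp: bij_betw_def inj_on_def)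

lemma code_less: "q \<in> controls p \<Longrightarrow> code q < card (controls p)"
  using bij by (auto simp: bij_betw_def)

lemma wf_T: "wf_transducer T"
proof -
  have start: "([p], Ready) \<in> controls p" "([], Ready) \<in> controls p"
    using stacks_self[of p "[]"] by (auto simp: controls_iff)
  have dec: "the_inv_into (controls p) code q \<in> controls p" if "q < card (controls p)" for q
    using the_inv_into_into[of code "controls p" q] bij that by (auto simp: bij_betw_def)
  show ?thesis
    unfolding wf_transducer_def transducer_of_def
    using start
    by (auto simp: code_less split: prod.splits dest: respond_acts)
      (metis code_less dec fst_conv respond_controls respond_acts subset_iff lessThan_iff image_iff)+
qed

lemma step_conf:
  assumes "(st, ph) \<in> controls p" "(st, ph) \<noteq> ([], Ready)"
    and "respond (st, ph) (input_at x h) (map (\<lambda>(h, w). w h) W) = ((st', ph'), d, acts, out)"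
  shows "tr_step T x (conf st ph h W os) = conf st' ph' (min (apply_move d h) (Suc (length x)))
    (map2 work_step W acts) (os @ (case out of None \<Rightarrow> [] | Some b \<Rightarrow> [b]))"
proof -
  have "([], Ready) \<in> controls p" by (simp add: controls_iff)
  then have "code (st, ph) \<noteq> code ([], Ready)"
    using assms(1,2) code_eq_iff by blast
  then show ?thesis
    using assms by (simp add: tr_step_def conf_def transducer_of_def decode)
qed

lemma map2_keep: "map2 work_step W (keep (map (\<lambda>(h, w). w h) W)) = W"
  by (auto simp: keep_def work_step_def zip_map2 map2_map_map zip_same_conv_map intro!: map_idI)

lemma map2_keep_upd:
  assumes "v < length W"
  shows "map2 work_step W ((keep (map (\<lambda>(h, w). w h) W))[v := act]) = W[v := work_step (W ! v) act]"
proof -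
  have "map2 work_step W ((keep (map (\<lambda>(h, w). w h) W))[v := act]) =
      (map2 work_step W (keep (map (\<lambda>(h, w). w h) W)))[v := work_step (W ! v) act]"
    using assms by (intro nth_equalityI) (auto simp: nth_list_update keep_def)
  then show ?thesis by (simp only: map2_keep)
qed

abbreviation "represented C W \<equiv> list_all2 (represents B) C W"

lemma represented_heads: "represented C W \<Longrightarrow> w \<in> set W \<Longrightarrow> fst w = 0"
  by (auto simp: list_all2_conv_all_nth represents_def in_set_conv_nth)

lemma represented_ok: "represented C W \<Longrightarrow> heads_ok (conf st ph h W os)"
  by (auto simp: heads_ok_def conf_def dest: represented_heads)

lemma heads_ok_upd:
  assumes "fst t \<le> N" "\<And>i. i < length W \<Longrightarrow> i \<noteq> v \<Longrightarrow> fst (W ! i) = 0"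
  shows "heads_ok (conf st ph h (W[v := t]) os)"
proof -
  have "fst (W[v := t] ! i) \<le> N" if "i < length W" for i
    using assms that by (cases "i = v") auto
  then show ?thesis
    by (force simp: heads_ok_def conf_def in_set_conv_nth)
qed

lemma reach_simple:
  assumes "(st, Ready) \<in> controls p" "st \<noteq> []" "represented C W"
    and "\<And>ws. respond (st, Ready) (input_at x h) ws = ((st', Ready), d, keep ws, out)"
  shows "reach (conf st Ready h W os) (conf st' Ready (min (apply_move d h) (Suc (length x))) W
    (os @ (case out of None \<Rightarrow> [] | Some b \<Rightarrow> [b])))"
  using reach_step[OF represented_ok[OF assms(3)], of st Ready h os] step_conf[OF assms(1) _ assms(4)] assms(2)
  by (simp add: map2_keep)

text \<open>Lifts an operation on one tape to the whole machine: the other tapes rewrite what they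
  hold and keep their heads at cell \<open>0\<close>.\<close>

lemma reach_counter:
  assumes "tape_run inc N ph t b t'"
    and "(st, Ready) \<in> controls p" "st \<noteq> []" "v < length W" "h \<le> Suc (length x)"
    and others: "\<And>i. i < length W \<Longrightarrow> i \<noteq> v \<Longrightarrow> fst (W ! i) = 0"
    and resp: "\<And>ph ws. respond (st, ph) (input_at x h) ws = counter_resp inc v k1 k0 (st, ph) ws"
  shows "reach (conf st ph h (W[v := t]) os) (conf (if b then k1 else k0) Ready h (W[v := t']) os)"
  using assms(1)
proof (induction rule: tape_run.induct)
  case (stop ph w hd b act t')
  have ok: "heads_ok (conf st ph h (W[v := (hd, w)]) os)"
    using stop(2) by (intro heads_ok_upd others) auto
  have "(st, ph) \<in> controls p" using assms(2) by (simp add: controls_iff)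
  then have "tr_step T x (conf st ph h (W[v := (hd, w)]) os) =
      conf (if b then k1 else k0) Ready h (W[v := t']) os"
    using step_conf[of st ph h "W[v := (hd, w)]" "if b then k1 else k0" Ready Stay _ None os]
      resp[of ph "map (\<lambda>(h, w). w h) (W[v := (hd, w)])"]
      assms(3-5) stop(1,3)
    by (simp add: counter_resp_def map2_keep_upd)
  then show ?case using reach_step[OF ok] by simp
next
  case (step ph w hd ph' act b t')
  have ok: "heads_ok (conf st ph h (W[v := (hd, w)]) os)"
    using step(2) by (intro heads_ok_upd others) auto
  have "(st, ph) \<in> controls p" using assms(2) by (simp add: controls_iff)
  then have "tr_step T x (conf st ph h (W[v := (hd, w)]) os) =
      conf st ph' h (W[v := work_step (hd, w) act]) os"
    using step_conf[of st ph h "W[v := (hd, w)]" st ph' Stay _ None os]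
      resp[of ph "map (\<lambda>(h, w). w h) (W[v := (hd, w)])"]
      assms(3-5) step(1)
    by (simp add: counter_resp_def map2_keep_upd)
  then have "reach (conf st ph h (W[v := (hd, w)]) os) (conf st ph' h (W[v := work_step (hd, w) act]) os)"
    using reach_step[OF ok] by simp
  then show ?case using step(4) by (rule reach_trans)
qed


lemma controls_next: "(st, ph) \<in> controls p \<Longrightarrow> st' \<in> succs st \<Longrightarrow> (st', Ready) \<in> controls p"
  by (rule controls_succs)

lemma represented_counter:
  assumes "represented C W" "v < length C"
  shows "v < length W" "represents B (C ! v) (W ! v)"
    "\<And>i. i < length W \<Longrightarrow> i \<noteq> v \<Longrightarrow> fst (W ! i) = 0"
  using assms represented_heads[OF assms(1)] by (auto simp: list_all2_conv_all_nth)

lemma reach_test: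
  assumes "(st, Ready) \<in> controls p" "st \<noteq> []" "h \<le> Suc (length x)" "represented C W" "v < length C"
    and resp: "\<And>ph ws. respond (st, ph) (input_at x h) ws = counter_resp False v k1 k0 (st, ph) ws"
  shows "C ! v = 0 \<Longrightarrow> reach (conf st Ready h W os) (conf k0 Ready h W os)"
    and "C ! v = Suc n \<Longrightarrow> \<exists>W'. reach (conf st Ready h W os) (conf k1 Ready h W' os) \<and> represented (C[v := n]) W'"
proof -
  note c = represented_counter[OF assms(4,5)]
  show "reach (conf st Ready h W os) (conf k0 Ready h W os)" if "C ! v = 0"
    using reach_counter[OF represents_zero[OF N, where t = "W ! v"] assms(1,2) c(1) assms(3) c(3) resp, where os = os] c(2) that
    by auto
  show "\<exists>W'. reach (conf st Ready h W os) (conf k1 Ready h W' os) \<and> represented (C[v := n]) W'"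
    if n: "C ! v = Suc n"
  proof -
    obtain t' where t': "tape_run False N Ready (W ! v) True t'" "represents B n t'"
      using represents_decr[OF N] c(2) n by metis
    show ?thesis
      using reach_counter[OF t'(1) assms(1,2) c(1) assms(3) c(3) resp, where os = os] t'(2) assms(4)
      by (intro exI[of _ "W[v := t']"]) (simp add: list_all2_update_cong)
  qed
qed

text \<open>The continuation \<open>k\<close> and the earlier output \<open>os\<close> are
  arbitrary, which carries the induction through sequencing and loops. The tapes \<open>W'\<close>
  are only claimed to exist because a number has many representations.\<close>

lemma reach_exec:
  assumes "exec x B c s os' s'" "snd s \<le> Suc (length x)" "(c # k, Ready) \<in> controls p" "represented (fst s) W"
  shows "\<exists>W'. reach (conf (c # k) Ready (snd s) W os) (conf k Ready (snd s') W' (os @ os')) \<and>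
    represented (fst s') W' \<and> snd s' \<le> Suc (length x)"
  using assms
proof (induction arbitrary: k W os rule: exec.induct)
  case (Skip s)
  then show ?case
    using reach_simple[of "com.Skip # k" "fst s" W "snd s" k Stay None os] by auto
next
  case (Out f C h)
  then show ?case
    using reach_simple[of "com.Out f # k" C W h k Stay "Some (f (input_at x h))" os] by auto
next
  case (Move d C h)
  then show ?case
    using reach_simple[of "com.Move d # k" C W h k d None os] by auto
next
  case (Inc v C h)
  then have rep: "represented C W" by simp
  note c = represented_counter[OF rep Inc(1)]
  obtain t' where t': "tape_run True N Ready (W ! v) True t'" "represents B (Suc (C ! v)) t'"
    using represents_incr[OF N c(2) Inc(2)] by metis
  show ?case
    using reach_counter[OF t'(1) Inc(4) _ c(1) _ c(3), of h k k os] t'(2) rep Inc(3)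
    by (intro exI[of _ "W[v := t']"]) (simp add: list_all2_update_cong)
next
  case (Seq a s os1 s1 b os2 s2)
  have in1: "(a # b # k, Ready) \<in> controls p" and in2: "(b # k, Ready) \<in> controls p"
    using controls_next[OF Seq.prems(2)] by (auto intro: controls_tail)
  have 0: "reach (conf (com.Seq a b # k) Ready (snd s) W os) (conf (a # b # k) Ready (snd s) W os)"
    using reach_simple[OF Seq.prems(2) _ Seq.prems(3), of "snd s" "a # b # k" Stay None os] Seq.prems(1) by simp
  obtain W1 where 1: "reach (conf (a # b # k) Ready (snd s) W os) (conf (b # k) Ready (snd s1) W1 (os @ os1))"
      "represented (fst s1) W1" "snd s1 \<le> Suc (length x)"
    using Seq.IH(1)[OF Seq.prems(1) in1 Seq.prems(3)] by blast
  obtain W2 where 2: "reach (conf (b # k) Ready (snd s1) W1 (os @ os1)) (conf k Ready (snd s2) W2 ((os @ os1) @ os2))"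
      "represented (fst s2) W2" "snd s2 \<le> Suc (length x)"
    using Seq.IH(2)[OF 1(3) in2 1(2)] by blast
  show ?case using reach_trans[OF reach_trans[OF 0 1(1)] 2(1)] 2 by auto
next
  case (Cond_0 v C b h os1 s1 a)
  have rep: "represented C W" using Cond_0.prems by simp
  have in1: "(b # k, Ready) \<in> controls p"
    using controls_next[OF Cond_0.prems(2)] by simp
  have 0: "reach (conf (Cond v a b # k) Ready h W os) (conf (b # k) Ready h W os)"
    using reach_test(1)[OF Cond_0.prems(2) _ _ rep Cond_0.hyps(1) respond.simps(8) Cond_0.hyps(2)] Cond_0.prems(1)
    by simp
  show ?case
    using Cond_0.IH[of k W os] in1 rep Cond_0.prems(1) reach_trans[OF 0] by auto
next
  case (Cond_Suc v C n a h os1 s1 b)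
  have rep: "represented C W" using Cond_Suc.prems by simp
  have in1: "(a # k, Ready) \<in> controls p"
    using controls_next[OF Cond_Suc.prems(2)] by simp
  obtain W' where 0: "reach (conf (Cond v a b # k) Ready h W os) (conf (a # k) Ready h W' os)"
      "represented (C[v := n]) W'"
    using reach_test(2)[OF Cond_Suc.prems(2) _ _ rep Cond_Suc.hyps(1) respond.simps(8) Cond_Suc.hyps(2)]
      Cond_Suc.prems(1) by auto
  show ?case
    using Cond_Suc.IH[of k W' os] in1 0(2) Cond_Suc.prems(1) reach_trans[OF 0(1)] by auto
next
  case (While_0 v C b h)
  have rep: "represented C W" using While_0.prems by simp
  show ?case
    using reach_test(1)[OF While_0.prems(2) _ _ rep While_0.hyps(1) respond.simps(9) While_0.hyps(2)]
      While_0.prems(1) rep by auto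
next
  case (While_Suc v C n b h os1 s1 os2 s2)
  have rep: "represented C W" using While_Suc.prems by simp
  have in1: "(b # While v b # k, Ready) \<in> controls p"
    using controls_next[OF While_Suc.prems(2)] by simp
  obtain W1 where 0: "reach (conf (While v b # k) Ready h W os) (conf (b # While v b # k) Ready h W1 os)"
      "represented (C[v := n]) W1"
    using reach_test(2)[OF While_Suc.prems(2) _ _ rep While_Suc.hyps(1) respond.simps(9) While_Suc.hyps(2)]
      While_Suc.prems(1) by auto
  obtain W2 where 1: "reach (conf (b # While v b # k) Ready h W1 os) (conf (While v b # k) Ready (snd s1) W2 (os @ os1))"
      "represented (fst s1) W2" "snd s1 \<le> Suc (length x)"
    using While_Suc.IH(1)[of "While v b # k" W1 os] While_Suc.prems(1) in1 0(2) by auto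
  obtain W3 where 2: "reach (conf (While v b # k) Ready (snd s1) W2 (os @ os1)) (conf k Ready (snd s2) W3 ((os @ os1) @ os2))"
      "represented (fst s2) W3" "snd s2 \<le> Suc (length x)"
    using While_Suc.IH(2)[OF 1(3) While_Suc.prems(2) 1(2)] by blast
  show ?case using reach_trans[OF reach_trans[OF 0(1) 1(1)] 2(1)] 2 by auto
next
  case (WhileIn_stop f h b C)
  then show ?case
    using reach_simple[of "WhileIn f b # k" C W h k Stay None os] by auto
next
  case (WhileIn_step f h b C os1 s1 os2 s2)
  have rep: "represented C W" using WhileIn_step.prems by simp
  have in1: "(b # WhileIn f b # k, Ready) \<in> controls p"
    using controls_next[OF WhileIn_step.prems(2)] by simp
  have 0: "reach (conf (WhileIn f b # k) Ready h W os) (conf (b # WhileIn f b # k) Ready h W os)"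
    using reach_simple[OF WhileIn_step.prems(2) _ rep, of h "b # WhileIn f b # k" Stay None os]
      WhileIn_step.hyps(1) WhileIn_step.prems(1) by simp
  obtain W2 where 1: "reach (conf (b # WhileIn f b # k) Ready h W os) (conf (WhileIn f b # k) Ready (snd s1) W2 (os @ os1))"
      "represented (fst s1) W2" "snd s1 \<le> Suc (length x)"
    using WhileIn_step.IH(1)[of "WhileIn f b # k" W os] WhileIn_step.prems(1) in1 rep by auto
  obtain W3 where 2: "reach (conf (WhileIn f b # k) Ready (snd s1) W2 (os @ os1)) (conf k Ready (snd s2) W3 ((os @ os1) @ os2))"
      "represented (fst s2) W3" "snd s2 \<le> Suc (length x)"
    using WhileIn_step.IH(2)[OF 1(3) WhileIn_step.prems(2) 1(2)] by blast
  show ?case using reach_trans[OF reach_trans[OF 0 1(1)] 2(1)] 2 by auto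
qed

text \<open>The machine is deterministic and stands still once it has halted, so the path from
  \<open>a\<close> to \<open>b\<close> contains all configurations of the run, for every
  \<open>i\<close>.\<close>

lemma reach_halts:
  assumes "reach a b" "heads_ok b" "t_state b = tr_halt T"
  shows "\<exists>i. (tr_step T x ^^ i) a = b" and "heads_ok ((tr_step T x ^^ i) a)"
proof -
  have "(\<exists>i. (tr_step T x ^^ i) a = b) \<and> (\<forall>i. heads_ok ((tr_step T x ^^ i) a))"
    using assms unfolding reach_def
  proof (induction rule: converse_rtranclp_induct)
    case base
    have "(tr_step T x ^^ i) b = b" for i
      using base by (induction i) (auto simp: tr_step_def)
    then show ?case using base by (auto intro: exI[of _ 0])
  next
    case (step y z)
    then obtain i where i: "(tr_step T x ^^ i) z = b" by blast
    have "(tr_step T x ^^ Suc i) y = b"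
      using step i by (simp del: funpow.simps add: funpow_Suc_right)
    moreover have "heads_ok ((tr_step T x ^^ j) y)" for j
      using step by (cases j) (auto simp del: funpow.simps simp add: funpow_Suc_right funpow_0)
    ultimately show ?case by blast
  qed
  then show "\<exists>i. (tr_step T x ^^ i) a = b" "heads_ok ((tr_step T x ^^ i) a)" by blast+
qed

lemma run_exec:
  assumes "exec x B p (replicate r 0, 0) os s'"
  shows "\<exists>i. t_state (tr_run T x i) = tr_halt T \<and> t_output (tr_run T x i) = os"
    and "w \<in> set (t_work (tr_run T x i)) \<Longrightarrow> fst w \<le> N"
proof -
  have init: "tr_init T = conf [p] Ready 0 (replicate r (0, \<lambda>_. 0)) []"
    by (simp add: tr_init_def conf_def transducer_of_def)
  have "represents B 0 (0, \<lambda>_. 0)"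
    using B by (auto simp: represents_def cells_def fun_eq_iff intro!: exI[of _ "[]"])
  then have rep: "represented (replicate r 0) (replicate r (0, \<lambda>_. 0))"
    by (auto simp: list_all2_conv_all_nth)
  have "([p], Ready) \<in> controls p" using stacks_self[of p "[]"] by (simp add: controls_iff)
  then obtain W' where W': "reach (tr_init T) (conf [] Ready (snd s') W' os)" "represented (fst s') W'"
    using reach_exec[OF assms, of "[]" "replicate r (0, \<lambda>_. 0)" "[]"] rep unfolding init by auto
  have halt: "t_state (conf [] Ready (snd s') W' os) = tr_halt T"
    by (simp add: conf_def transducer_of_def)
  note h = reach_halts[OF W'(1) represented_ok[OF W'(2)] halt]
  show "\<exists>i. t_state (tr_run T x i) = tr_halt T \<and> t_output (tr_run T x i) = os"
    using h(1) halt unfolding tr_run_def by (metis conf_def tr_config.select_convs(4))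
  show "fst w \<le> N" if "w \<in> set (t_work (tr_run T x i))"
    using h(2)[of i] that unfolding tr_run_def heads_ok_def by blast
qed

end

text \<open>A counter bounded by \<open>B n\<close> has at most \<open>log 2 (2 * B n)\<close>
  digits, and space is measured by head positions. The growth condition admits every polynomial
  bound.\<close>

lemma logspace_computableI:
  fixes B :: "nat \<Rightarrow> nat"
  assumes run: "\<And>x. \<exists>s'. exec x (B (length x)) p (replicate r 0, 0) (f x) s'"
    and B: "\<And>n. B n > 0" "(\<lambda>n. ln (real (B n))) \<in> O(\<lambda>n. ln (real n))"
  shows "logspace_computable f"
proof -
  obtain code where code: "bij_betw code (controls p) {..<card (controls p)}"
    using ex_bij_betw_finite_nat[OF finite_controls[of p]] atLeast0LessThan by metis
  define N where "N n = nat \<lfloor>log 2 (2 * B n)\<rfloor>" for n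
  have N: "l \<le> N n" if "2 ^ l \<le> 2 * B n" for l n
  proof -
    have "real (2 ^ l) \<le> real (2 * B n)" using that by (simp only: of_nat_le_iff)
    then have "real l \<le> log 2 (2 * B n)" using B(1)[of n] by (simp add: le_log_iff powr_realpow)
    then show ?thesis unfolding N_def by linarith
  qed
  have comp: "compiled p code (B (length x)) (N (length x))" for x :: "bool list"
    using code B(1) N by unfold_locales auto
  let ?T = "transducer_of r p code"
  have "wf_transducer ?T" using compiled.wf_T[OF comp] .
  moreover have "computes ?T f"
    unfolding computes_def using compiled.run_exec(1)[OF comp] run by metis
  moreover have "runs_in_space ?T (\<lambda>n. Suc (N n))"
    unfolding runs_in_space_def less_Suc_eq_le using compiled.run_exec(2)[OF comp] run by metis
  moreover have "(\<lambda>n. real (Suc (N n))) \<in> O(\<lambda>n. ln (real n))"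
  proof -
    have "real (Suc (N n)) \<le> 2 + ln (real (B n)) / ln 2" for n
    proof -
      have "real (N n) \<le> log 2 (2 * B n)" unfolding N_def using B(1)[of n] by simp
      then show ?thesis using B(1)[of n] by (simp add: log_def ln_mult add_divide_distrib)
    qed
    then have "(\<lambda>n. real (Suc (N n))) \<in> O(\<lambda>n. 2 + ln (real (B n)) / ln 2)"
      by (intro landau_o.big_mono always_eventually) (smt (verit) of_nat_0_le_iff real_norm_def)
    also have "(\<lambda>n. 2 + ln (real (B n)) / ln 2) \<in> O(\<lambda>n. ln (real n))"
    proof (intro sum_in_bigo)
      show "(\<lambda>n. 2) \<in> O(\<lambda>n. ln (real n))" by real_asymp
      show "(\<lambda>n. ln (real (B n)) / ln 2) \<in> O(\<lambda>n. ln (real n))" using B(2) by simp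
    qed
    finally show ?thesis .
  qed
  ultimately show ?thesis unfolding logspace_computable_def by blast
qed

section \<open>Layered NOR networks as models\<close>

primrec rank_fm :: "nat \<Rightarrow> fm" where
  "rank_fm 0 = Bot"
| "rank_fm (Suc k) = Imp (Imp Bot Bot) (rank_fm k)"

primrec nor_fm :: "nat \<Rightarrow> fm" where
  "nor_fm 0 = Var 0"
| "nor_fm (Suc k) = Imp (nor_fm k) (rank_fm k)"

lemma vars_rank_fm: "vars (rank_fm k) = {}"
  by (induction k) auto

lemma vars_nor_fm: "vars (nor_fm k) = {0}"
  by (induction k) (auto simp: vars_rank_fm)

lemma nor_fm_in_FPL_Imp1: "nor_fm k \<in> FPL_Imp1"
proof -
  have "implicational (rank_fm j)" for j by (induction j) auto
  then have "implicational (nor_fm k)" by (induction k) auto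
  then show ?thesis by (simp add: FPL_Imp1_def vars_nor_fm)
qed

text \<open>
  A network has \<open>L\<close> levels, each a row of \<open>L\<close> positions with \<open>G\<close> gates. The gate \<open>g\<close> at position
  \<open>i\<close> reads the gate \<open>g'\<close> at position \<open>i + d - 1\<close> of the next level if \<open>E d g g'\<close>.
\<close>

locale network =
  fixes L G :: nat and E :: "nat \<Rightarrow> nat \<Rightarrow> nat \<Rightarrow> bool" and ini :: "nat \<Rightarrow> nat \<Rightarrow> bool"
  assumes L: "L > 0" and G: "G > 0"
    and total: "\<And>g. g < G \<Longrightarrow> \<exists>g'<G. E 1 g g'"
begin

text \<open>Written with \<open>Suc i' = i\<close> because truncated subtraction would make position
  \<open>0\<close> its own left neighbour.\<close>

definition edge :: "nat \<Rightarrow> nat \<Rightarrow> nat \<Rightarrow> nat \<Rightarrow> bool" where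
  "edge i g i' g' \<longleftrightarrow> Suc i' = i \<and> E 0 g g' \<or> i' = i \<and> E 1 g g' \<or> i' = Suc i \<and> E 2 g g'"

primrec gate_val :: "nat \<Rightarrow> nat \<Rightarrow> nat \<Rightarrow> bool" where
  "gate_val 0 i g = ini i g"
| "gate_val (Suc h) i g = (\<forall>i'<L. \<forall>g'<G. edge i g i' g' \<longrightarrow> \<not> gate_val h i' g')"

text \<open>A mixed-radix numbering: a row of the adjacency matrix becomes three nested loops, and
  the output gate becomes state \<open>0\<close>. Levels count from the top, heights in
  \<open>gate_val\<close> from the bottom.\<close>

definition node :: "nat \<Rightarrow> nat \<Rightarrow> nat \<Rightarrow> nat" where
  "node l i g = (l * L + i) * G + g"

definition level :: "nat \<Rightarrow> nat" where "level u = u div G div L"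
definition pos :: "nat \<Rightarrow> nat" where "pos u = u div G mod L"
definition gate :: "nat \<Rightarrow> nat" where "gate u = u mod G"

lemma decode [simp]:
  assumes "i < L" "g < G"
  shows "level (node l i g) = l" "pos (node l i g) = i" "gate (node l i g) = g"
  using assms by (auto simp: node_def level_def pos_def gate_def div_mult_self3)

lemma node_less: "l < L \<Longrightarrow> i < L \<Longrightarrow> g < G \<Longrightarrow> node l i g < L * L * G"
proof -
  assume a: "l < L" "i < L" "g < G"
  then have "l * L + i < L * L"
    by (metis add_less_cancel_left less_le_trans mult_Suc mult.commute Suc_leI mult_le_mono1 add.commute)
  then have "Suc (l * L + i) * G \<le> L * L * G" by (intro mult_le_mono1) simp
  then show ?thesis using a by (simp add: node_def)
qed

lemma level_less: "u < L * L * G \<Longrightarrow> level u < L"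
  by (simp add: level_def less_mult_imp_div_less)

lemma pos_less: "pos u < L" and gate_less: "gate u < G"
  using L G by (auto simp: pos_def gate_def)

definition model :: "nat model" where
  "model = \<lparr>states = {..<L * L * G},
     rel = {(u, v). u < L * L * G \<and> v < L * L * G \<and>
       (level u + 2 \<le> level v \<or> Suc (level u) = level v \<and> edge (pos u) (gate u) (pos v) (gate v))},
     val = (\<lambda>p. if p = 0 then {u. u < L * L * G \<and> Suc (level u) = L \<and> ini (pos u) (gate u)} else {})\<rparr>"

lemma model_simps:
  "states model = {..<L * L * G}"
  "(u, v) \<in> rel model \<longleftrightarrow> u < L * L * G \<and> v < L * L * G \<and>
     (level u + 2 \<le> level v \<or> Suc (level u) = level v \<and> edge (pos u) (gate u) (pos v) (gate v))"
  "u \<in> val model 0 \<longleftrightarrow> u < L * L * G \<and> Suc (level u) = L \<and> ini (pos u) (gate u)"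
  by (auto simp: model_def)

text \<open>Every pair of the relation goes down at least one level, so two in a row go down at
  least two, where the relation is full.\<close>

lemma fpl_instance_model: "fpl_instance \<phi> model 0"
proof -
  have "trans (rel model)" by (rule transI) (auto simp: model_simps)
  moreover have "irrefl (rel model)" by (rule irreflI) (auto simp: model_simps)
  moreover have "b \<in> val model p" if "a \<in> val model p" "(a, b) \<in> rel model" for a b p
  proof -
    have "level a < level b" "level b < L" using that level_less by (auto simp: model_simps)
    then show ?thesis using that by (auto simp: model_def split: if_splits)
  qed
  moreover have "{..<L * L * G} \<noteq> {}"
    using L G by (simp add: lessThan_empty_iff)
  ultimately show ?thesis
    using L G by (auto simp: fpl_instance_def fpl_model_def model_def split: if_splits)
qed

text \<open>The successor lies straight below, which is why \<open>total\<close> speaks of offset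
  \<open>1\<close>: a neighbour to the side could be missing at the border.\<close>

lemma ex_successor:
  assumes "u < L * L * G" "Suc (level u) < L"
  shows "\<exists>v. (u, v) \<in> rel model \<and> level v = Suc (level u)"
proof -
  obtain g where g: "g < G" "E 1 (gate u) g" using total[OF gate_less] by blast
  let ?v = "node (Suc (level u)) (pos u) g"
  have "edge (pos u) (gate u) (pos u) g" using g by (simp add: edge_def)
  then have "(u, ?v) \<in> rel model"
    using assms g node_less[OF assms(2) pos_less g(1)] by (simp add: model_simps pos_less)
  then show ?thesis using g by (intro exI[of _ ?v]) (simp add: pos_less)
qed

lemma sat_rank_fm: "u < L * L * G \<Longrightarrow> sat model u (rank_fm k) \<longleftrightarrow> L \<le> level u + k"
proof (induction k arbitrary: u)
  case 0
  then show ?case using level_less[of u] by simp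
next
  case (Suc k)
  have "sat model u (rank_fm (Suc k)) \<longleftrightarrow> (\<forall>v. (u, v) \<in> rel model \<longrightarrow> L \<le> level v + k)"
    using Suc.IH by (auto simp: model_simps)
  also have "\<dots> \<longleftrightarrow> L \<le> level u + Suc k"
  proof
    assume a: "\<forall>v. (u, v) \<in> rel model \<longrightarrow> L \<le> level v + k"
    show "L \<le> level u + Suc k"
      using ex_successor[OF Suc.prems] a by (cases "Suc (level u) < L") auto
  qed (auto simp: model_simps)
  finally show ?case .
qed

text \<open>
  The successors below the next level satisfy \<open>rank_fm k\<close>, hence do not matter for \<open>nor_fm (Suc k)\<close>;
  on the next level \<open>rank_fm k\<close> is false.
\<close>

lemma sat_nor_fm:
  "u < L * L * G \<Longrightarrow> Suc (level u + h) = L \<Longrightarrow> sat model u (nor_fm h) \<longleftrightarrow> gate_val h (pos u) (gate u)"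
proof (induction h arbitrary: u)
  case 0
  then show ?case by (simp add: model_simps)
next
  case (Suc h)
  have "sat model u (nor_fm (Suc h)) \<longleftrightarrow>
      (\<forall>v. (u, v) \<in> rel model \<longrightarrow> Suc (level u) = level v \<longrightarrow> \<not> sat model v (nor_fm h))"
    using Suc.prems by (auto simp: model_simps sat_rank_fm)
  also have "\<dots> \<longleftrightarrow>
      (\<forall>v. (u, v) \<in> rel model \<longrightarrow> Suc (level u) = level v \<longrightarrow> \<not> gate_val h (pos v) (gate v))"
    using Suc.IH Suc.prems(2) by (auto simp: model_simps)
  also have "\<dots> \<longleftrightarrow> gate_val (Suc h) (pos u) (gate u)"
  proof
    assume a: "\<forall>v. (u, v) \<in> rel model \<longrightarrow> Suc (level u) = level v \<longrightarrow> \<not> gate_val h (pos v) (gate v)"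
    show "gate_val (Suc h) (pos u) (gate u)"
      unfolding gate_val.simps
    proof (intro allI impI)
      fix i g assume ig: "i < L" "g < G" "edge (pos u) (gate u) i g"
      have "Suc (level u) < L" using Suc.prems by simp
      from a[rule_format, of "node (Suc (level u)) i g"] node_less[OF this ig(1,2)] ig Suc.prems(1)
      show "\<not> gate_val h i g" by (simp add: model_simps)
    qed
  qed (auto simp: model_simps pos_less gate_less)
  finally show ?case .
qed

corollary sat_model_nor_fm: "sat model 0 (nor_fm (L - 1)) \<longleftrightarrow> gate_val (L - 1) 0 0"
  using sat_nor_fm[of 0 "L - 1"] L G by (simp add: level_def pos_def gate_def)

section \<open>The code of the model, node by node\<close>

lemma concat_map_upt_mult:
  "concat (map f [0..<a * b]) = concat (map (\<lambda>i. concat (map (\<lambda>j. f (i * b + j)) [0..<b])) [0..<a])"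
proof (induction a)
  case (Suc a)
  have "[0..<Suc a * b] = [0..<a * b] @ map (\<lambda>j. j + a * b) [0..<b]"
    using upt_add_eq_append[of 0 "a * b" b] by (simp add: map_add_upt add.commute)
  then show ?case using Suc by (simp add: o_def add.commute)
qed simp

definition all_nodes :: "(nat \<Rightarrow> nat \<Rightarrow> nat \<Rightarrow> 'a list) \<Rightarrow> 'a list" where
  "all_nodes f = concat (map (\<lambda>l. concat (map (\<lambda>i. concat (map (\<lambda>g. f l i g) [0..<G])) [0..<L])) [0..<L])"

lemma concat_nodes: "concat (map f [0..<L * L * G]) = all_nodes (\<lambda>l i g. f (node l i g))"
  unfolding all_nodes_def concat_map_upt_mult[of f] concat_map_upt_mult[of _ L L]
  by (simp add: node_def)

lemma map_nodes: "map f [0..<L * L * G] = all_nodes (\<lambda>l i g. [f (node l i g)])"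
  using concat_nodes[of "\<lambda>u. [f u]"] by simp

lemma all_nodes_cong:
  "(\<And>l i g. l < L \<Longrightarrow> i < L \<Longrightarrow> g < G \<Longrightarrow> f l i g = f' l i g) \<Longrightarrow> all_nodes f = all_nodes f'"
  unfolding all_nodes_def by (intro arg_cong[where f = concat] map_cong refl) auto

text \<open>Only variable \<open>0\<close> occurs in the formula, hence one characteristic vector;
  the last bit is the state \<open>0\<close> in unary.\<close>

lemma enc_model:
  "enc_instance (nor_fm k) model 0 =
     enc_fm (nor_fm k) @ unary (L * L * G) @
     all_nodes (\<lambda>l i g. all_nodes (\<lambda>l' i' g'. [l + 2 \<le> l' \<or> Suc l = l' \<and> edge i g i' g'])) @
     all_nodes (\<lambda>l i g. [Suc l = L \<and> ini i g]) @ [False]"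
proof -
  have 1: "map (\<lambda>j. (node l i g, j) \<in> rel model) [0..<L * L * G] =
      all_nodes (\<lambda>l' i' g'. [l + 2 \<le> l' \<or> Suc l = l' \<and> edge i g i' g'])"
    if "l < L" "i < L" "g < G" for l i g
    unfolding map_nodes using that by (intro all_nodes_cong) (simp add: model_simps node_less)
  have 2: "map (\<lambda>i. i \<in> val model 0) [0..<L * L * G] = all_nodes (\<lambda>l i g. [Suc l = L \<and> ini i g])"
    unfolding map_nodes by (intro all_nodes_cong) (simp add: model_simps node_less)
  show ?thesis
    unfolding enc_instance_def Let_def
    by (simp add: vars_nor_fm model_simps(1) concat_nodes 2 unary_def cong: all_nodes_cong)
      (simp add: 1 cong: all_nodes_cong)
qed

end

section \<open>Turing machines as networks\<close>

text \<open>Cell \<open>0\<close> is a wall, so tape cell \<open>j\<close> is cell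
  \<open>Suc j\<close>, the shift that \<open>input_at\<close> has as well. \<open>StartWall\<close>
  releases the head in the first step; thus an initial cell depends on nothing but the input symbol
  at its position.\<close>

datatype cell = Wall | StartWall | Rej | Sym nat | Head nat nat

datatype gate = Y cell | Z cell cell cell

context
  fixes M :: tm
begin

text \<open>Halting becomes an ordinary transition that rewrites the symbol in place, so one local
  rule covers halted and running machines.\<close>

definition halting_delta :: "nat \<Rightarrow> nat \<Rightarrow> nat \<times> nat \<times> move" where
  "halting_delta q a = (if q = tm_accept M \<or> q = tm_reject M then (q, a, Stay) else tm_delta M q a)"

definition rejecting :: "cell \<Rightarrow> bool" where
  "rejecting c \<longleftrightarrow> c = Rej \<or> (\<exists>a. c = Head (tm_reject M) a)"

fun from_left :: "cell \<Rightarrow> nat option" where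
  "from_left StartWall = Some (tm_start M)"
| "from_left (Head q b) = (case halting_delta q b of (q', _, d) \<Rightarrow> if d = Rgt then Some q' else None)"
| "from_left _ = None"

fun from_right :: "cell \<Rightarrow> nat option" where
  "from_right (Head q b) = (case halting_delta q b of (q', _, d) \<Rightarrow> if d = Lft then Some q' else None)"
| "from_right _ = None"

fun local_next :: "cell \<Rightarrow> cell \<Rightarrow> cell \<Rightarrow> cell" where
  "local_next a Rej c = Rej"
| "local_next a Wall c = Wall"
| "local_next a StartWall c = Wall"
| "local_next a (Sym s) c =
     (case from_left a of Some q \<Rightarrow> Head q s
      | None \<Rightarrow> (case from_right c of Some q \<Rightarrow> Head q s | None \<Rightarrow> Sym s))"
| "local_next a (Head q s) c =
     (case halting_delta q s of (q', s', d) \<Rightarrow>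
       if d = Stay \<or> d = Lft \<and> a = Wall then Head q' s' else Sym s')"

text \<open>
  A rejecting head turns into \<open>Rej\<close>, which then spreads to the left. The first case never occurs
  in a computation; it provides every gate \<open>Y b\<close> with a successor.
\<close>

definition next_cell :: "cell \<Rightarrow> cell \<Rightarrow> cell \<Rightarrow> cell" where
  "next_cell a b c =
     (if a = Wall \<and> c = Wall then b
      else if rejecting b \<or> rejecting c then Rej
      else local_next a b c)"

definition init_cell :: "input_symbol \<Rightarrow> cell" where
  "init_cell s = (case s of Left_End \<Rightarrow> StartWall | Bit b \<Rightarrow> Sym (bit_symbol b) | Right_End \<Rightarrow> Sym 0)"

text \<open>A NOR of three negated statements about cells is the conjunction expressed by
  \<open>Z\<close>. A NOR over all neighbourhoods that produce \<open>s\<close> is again a negated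
  statement, as \<open>Y s\<close> demands.\<close>

fun linked :: "nat \<Rightarrow> gate \<Rightarrow> gate \<Rightarrow> bool" where
  "linked d (Y s) (Z a b c) \<longleftrightarrow> d = 1 \<and> next_cell a b c = s"
| "linked d (Z a b c) (Y s) \<longleftrightarrow> d = 0 \<and> s = a \<or> d = 1 \<and> s = b \<or> d = 2 \<and> s = c"
| "linked d _ _ \<longleftrightarrow> False"

definition input_gate :: "input_symbol \<Rightarrow> gate \<Rightarrow> bool" where
  "input_gate s g = (case g of Y c \<Rightarrow> init_cell s \<noteq> c | Z _ _ _ \<Rightarrow> False)"

definition cell_set :: "cell set" where
  "cell_set = {Wall, StartWall, Rej} \<union> Sym ` {..<tm_symbols M} \<union>
     (\<lambda>(q, a). Head q a) ` ({..<tm_states M} \<times> {..<tm_symbols M})"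

definition gate_set :: "gate set" where
  "gate_set = Y ` cell_set \<union> (\<lambda>(a, b, c). Z a b c) ` (cell_set \<times> cell_set \<times> cell_set)"

lemma finite_gate_set: "finite gate_set"
  by (simp add: gate_set_def cell_set_def)

lemma gate_set_iff: "Y c \<in> gate_set \<longleftrightarrow> c \<in> cell_set"
  "Z a b c \<in> gate_set \<longleftrightarrow> a \<in> cell_set \<and> b \<in> cell_set \<and> c \<in> cell_set"
  by (force simp: gate_set_def)+

lemma cell_set_iff: "Wall \<in> cell_set" "StartWall \<in> cell_set" "Rej \<in> cell_set"
  "Sym a \<in> cell_set \<longleftrightarrow> a < tm_symbols M"
  "Head q a \<in> cell_set \<longleftrightarrow> q < tm_states M \<and> a < tm_symbols M"
  by (auto simp: cell_set_def)

lemma linked_total: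
  assumes "g \<in> gate_set"
  shows "\<exists>g'\<in>gate_set. linked 1 g g'"
proof (cases g)
  case (Y s)
  have "linked 1 g (Z Wall s Wall)" by (simp add: Y next_cell_def)
  moreover have "Z Wall s Wall \<in> gate_set" using assms by (simp add: Y gate_set_iff cell_set_iff)
  ultimately show ?thesis by blast
next
  case (Z a b c)
  have "linked 1 g (Y b)" by (simp add: Z)
  moreover have "Y b \<in> gate_set" using assms by (simp add: Z gate_set_iff)
  ultimately show ?thesis by blast
qed

section \<open>Evolution of the cells and its agreement with the machine\<close>

primrec evolve :: "bool list \<Rightarrow> nat \<Rightarrow> nat \<Rightarrow> cell" where
  "evolve x 0 i = init_cell (input_at x i)"
| "evolve x (Suc t) i =
     next_cell (if i = 0 then Wall else evolve x t (i - 1)) (evolve x t i) (evolve x t (Suc i))"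

lemma next_cell_wall: "next_cell a b c \<in> {Wall, StartWall} \<Longrightarrow> b \<in> {Wall, StartWall}"
  by (cases b) (auto simp: next_cell_def split: if_splits option.splits prod.splits)

lemma evolve_pos: "i > 0 \<Longrightarrow> evolve x t i \<notin> {Wall, StartWall}"
proof (induction t)
  case 0
  then show ?case by (auto simp: input_at_def init_cell_def)
next
  case (Suc t)
  then show ?case using next_cell_wall by (metis evolve.simps(2))
qed

lemma evolve_0: "evolve x t 0 \<in> {Wall, StartWall, Rej}"
proof (induction t)
  case (Suc t)
  then show ?case by (auto simp: next_cell_def split: if_splits)
qed (auto simp: input_at_def init_cell_def)

text \<open>At position \<open>0\<close> the gates \<open>Z a b c\<close> lack their left input, so
  they are true for all \<open>a\<close> at once. This is harmless because the next content does not
  depend on \<open>a\<close>; \<open>c \<noteq> Wall\<close> excludes the artificial first case of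
  \<open>next_cell\<close>.\<close>

lemma next_cell_0: "b \<in> {Wall, StartWall, Rej} \<Longrightarrow> c \<noteq> Wall \<Longrightarrow> next_cell a b c = next_cell a' b c"
  by (auto simp: next_cell_def)

lemma evolve_rejecting_left: "rejecting (evolve x t (Suc i)) \<Longrightarrow> evolve x (Suc t) i = Rej"
  using evolve_pos[of "Suc i" x t] by (auto simp: next_cell_def)

lemma evolve_rejecting:
  "rejecting (evolve x t i) \<Longrightarrow> d \<le> i \<Longrightarrow> rejecting (evolve x (t + d) (i - d))"
proof (induction d)
  case (Suc d)
  then have "evolve x (Suc (t + d)) (i - Suc d) = Rej"
    using evolve_rejecting_left[of x "t + d" "i - Suc d"] by (simp add: Suc_diff_Suc)
  then show ?case by (simp add: rejecting_def)
qed simp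

lemma evolve_Rej: "evolve x t i = Rej \<Longrightarrow> evolve x (t + d) i = Rej"
  by (induction d) (auto simp: next_cell_def rejecting_def)

definition config_cell :: "tm_config \<Rightarrow> nat \<Rightarrow> cell" where
  "config_cell c i = (case i of 0 \<Rightarrow> Wall
     | Suc j \<Rightarrow> if c_head c = j then Head (c_state c) (c_tape c j) else Sym (c_tape c j))"

lemma config_cell_0: "config_cell c 0 = Wall" "config_cell c (Suc j) \<noteq> Wall"
  by (auto simp: config_cell_def)

lemma tm_step_halting:
  "tm_step M c = (case halting_delta (c_state c) (c_tape c (c_head c)) of (q, b, d) \<Rightarrow>
     \<lparr>c_state = q, c_head = apply_move d (c_head c), c_tape = (c_tape c)(c_head c := b)\<rparr>)"
  by (auto simp: tm_step_def halting_delta_def)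

text \<open>A rejecting state is excluded because \<open>next_cell\<close> replaces its head by
  \<open>Rej\<close>. Otherwise the local rule is the machine step.\<close>

lemma config_cell_step:
  assumes "c_state c \<noteq> tm_reject M"
  shows "config_cell (tm_step M c) i =
    next_cell (if i = 0 then Wall else config_cell c (i - 1)) (config_cell c i) (config_cell c (Suc i))"
proof -
  obtain q b d where qbd: "halting_delta (c_state c) (c_tape c (c_head c)) = (q, b, d)"
    by (cases "halting_delta (c_state c) (c_tape c (c_head c))") auto
  have step: "tm_step M c =
      \<lparr>c_state = q, c_head = apply_move d (c_head c), c_tape = (c_tape c)(c_head c := b)\<rparr>"
    by (simp add: tm_step_halting qbd)
  have nr: "\<not> rejecting (config_cell c j)" for j
    using assms by (auto simp: rejecting_def config_cell_def split: nat.splits)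
  show ?thesis
  proof (cases i)
    case 0
    then show ?thesis
      using nr by (simp add: next_cell_def config_cell_0 rejecting_def)
  next
    case (Suc j)
    have "next_cell (config_cell c j) (config_cell c (Suc j)) (config_cell c (Suc (Suc j))) =
        local_next (config_cell c j) (config_cell c (Suc j)) (config_cell c (Suc (Suc j)))"
      using nr by (simp add: next_cell_def config_cell_0)
    also have "\<dots> = config_cell (tm_step M c) (Suc j)"
      unfolding step
      by (cases d; cases j; cases "c_head c"; use qbd in \<open>auto simp: config_cell_def\<close>)
    finally show ?thesis using Suc by simp
  qed
qed

definition config :: "bool list \<Rightarrow> nat \<Rightarrow> tm_config" where
  "config x t = (tm_step M ^^ t) (tm_init M x)"

lemma config_Suc: "config x (Suc t) = tm_step M (config x t)"
  by (simp add: config_def)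

text \<open>The cells lag one step behind the machine, since the first step only turns
  \<open>StartWall\<close> into a head.\<close>

lemma evolve_config:
  "(\<And>t'. t' < t \<Longrightarrow> c_state (config x t') \<noteq> tm_reject M) \<Longrightarrow>
    evolve x (Suc t) i = config_cell (config x t) i"
proof (induction t arbitrary: i)
  case 0
  show ?case
  proof (cases i)
    case 0
    have "evolve x 0 1 \<noteq> Wall" using evolve_pos[of 1 x 0] by auto
    then show ?thesis
      by (auto simp: 0 next_cell_def config_cell_def rejecting_def input_at_def init_cell_def)
  next
    case (Suc j)
    then show ?thesis
      by (auto simp: next_cell_def config_cell_def rejecting_def input_at_def init_cell_def
        config_def tm_init_def Suc_le_eq)
  qed
next
  case (Suc t)
  have "evolve x (Suc t) i = config_cell (config x t) i" for i
    using Suc by simp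
  then show ?case
    using config_cell_step[of "config x t" i] Suc.prems[of t] by (simp add: config_Suc del: evolve.simps(2))
      (simp add: evolve.simps(2)[of x "Suc t"] del: evolve.simps(2))
qed

lemma config_halted:
  assumes "c_state (config x t) \<in> {tm_accept M, tm_reject M}" "t \<le> t'"
  shows "config x t' = config x t"
  using assms(2)
proof (induction t' rule: dec_induct)
  case (step n)
  then show ?case using assms(1) by (auto simp: config_Suc tm_step_def)
qed simp

lemma config_head: "c_head (config x t) \<le> t"
proof (induction t)
  case 0
  show ?case by (simp add: config_def tm_init_def)
next
  case (Suc t)
  have "apply_move d h \<le> Suc h" for d h by (cases d) auto
  then have "c_head (tm_step M c) \<le> Suc (c_head c)" for c
    by (simp add: tm_step_halting split: prod.splits)
  then show ?case using Suc order_trans by (fastforce simp: config_Suc)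
qed

text \<open>The time budget: one step to release the head, at most \<open>T\<close> until the first
  rejection, at most \<open>T\<close> for the signal to walk back to cell \<open>1\<close>, and one
  to enter cell \<open>0\<close>. On accepted inputs cell \<open>0\<close> remains a wall.\<close>

lemma evolve_decides:
  assumes wf: "wf_tm M" and dec: "decides_in_time M A T" and P: "2 * T (length x) + 2 \<le> P"
  shows "evolve x P 0 = Rej \<longleftrightarrow> x \<notin> A"
proof (cases "x \<in> A")
  case True
  let ?n = "T (length x)"
  have acc: "c_state (config x ?n) = tm_accept M"
    using dec True by (auto simp: decides_in_time_def config_def)
  \<comment> \<open>At the later of the two times both halted configurations would persist, which
    would identify the accepting and the rejecting state.\<close>
  have "c_state (config x t) \<noteq> tm_reject M" for t
    using config_halted[of x t "max t ?n"] config_halted[of x ?n "max t ?n"] acc wf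
    by (auto simp: wf_tm_def)
  then have "evolve x (Suc (P - 1)) 0 = config_cell (config x (P - 1)) 0"
    by (intro evolve_config) auto
  moreover have "Suc (P - 1) = P" using P by simp
  ultimately show ?thesis using True by (simp only: config_cell_0) simp
next
  case False
  let ?n = "T (length x)"
  have rej: "c_state (config x ?n) = tm_reject M"
    using dec False by (auto simp: decides_in_time_def config_def)
  \<comment> \<open>The least such time, as \<open>evolve_config\<close> requires that no earlier
    configuration rejects.\<close>
  define t where "t = (LEAST t. c_state (config x t) = tm_reject M)"
  have t: "c_state (config x t) = tm_reject M" "t \<le> ?n"
    unfolding t_def using rej by (auto intro: LeastI Least_le)
  have "evolve x (Suc t) i = config_cell (config x t) i" for i
    by (intro evolve_config) (use not_less_Least in \<open>auto simp: t_def\<close>)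
  then have "rejecting (evolve x (Suc t) (Suc (c_head (config x t))))"
    using t(1) by (simp add: rejecting_def config_cell_def del: evolve.simps)
  from evolve_rejecting[OF this, of "c_head (config x t)"]
  have "rejecting (evolve x (Suc t + c_head (config x t)) (Suc 0))" by (simp del: evolve.simps)
  then have "evolve x (Suc (Suc t + c_head (config x t))) 0 = Rej"
    by (rule evolve_rejecting_left)
  then have "evolve x (Suc (Suc t + c_head (config x t)) + (P - Suc (Suc t + c_head (config x t)))) 0 = Rej"
    by (rule evolve_Rej)
  moreover have "Suc (Suc t + c_head (config x t)) \<le> P"
    using P t(2) config_head[of x t] by simp
  ultimately show ?thesis using False le_add_diff_inverse by metis
qed

lemma next_cell_closed:
  assumes "wf_tm M" "a \<in> cell_set" "b \<in> cell_set" "c \<in> cell_set"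
  shows "next_cell a b c \<in> cell_set"
proof -
  have hd: "fst (halting_delta q s) < tm_states M \<and> fst (snd (halting_delta q s)) < tm_symbols M"
    if "q < tm_states M" "s < tm_symbols M" for q s
  proof -
    have "case tm_delta M q s of (q', b, d) \<Rightarrow> q' < tm_states M \<and> b < tm_symbols M"
      using assms(1) that by (simp add: wf_tm_def)
    then show ?thesis using that by (auto simp: halting_delta_def)
  qed
  have l: "from_left a = Some q \<Longrightarrow> q < tm_states M" for q
    using assms(1,2) hd by (cases a) (auto simp: cell_set_iff wf_tm_def split: prod.splits if_splits, metis fst_conv)
  have r: "from_right c = Some q \<Longrightarrow> q < tm_states M" for q
    using assms(4) hd by (cases c) (auto simp: cell_set_iff split: prod.splits if_splits, metis fst_conv)
  have "local_next a b c \<in> cell_set"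
    using assms(3) l r
  proof (cases b)
    case (Head q s)
    then show ?thesis using hd[of q s] assms(3) by (auto simp: cell_set_iff split: prod.splits)
  qed (auto simp: cell_set_iff split: option.splits)
  then show ?thesis using assms(3) by (auto simp: next_cell_def cell_set_iff)
qed

lemma evolve_closed: "wf_tm M \<Longrightarrow> evolve x t i \<in> cell_set"
proof (induction t arbitrary: i)
  case 0
  then show ?case
    by (auto simp: init_cell_def cell_set_iff wf_tm_def bit_symbol_def split: input_symbol.splits)
next
  case (Suc t)
  then show ?case using next_cell_closed by (simp add: cell_set_iff)
qed

section \<open>Numbering of the gates and correctness of the network\<close>

definition gates :: "gate list" where
  "gates = (SOME gs. set gs = gate_set \<and> gs \<noteq> [] \<and> gs ! 0 = Y Rej)"

lemma gates: "set gates = gate_set" "gates \<noteq> []" "gates ! 0 = Y Rej"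
proof -
  obtain gs where "set gs = gate_set" using finite_list[OF finite_gate_set] by blast
  \<comment> \<open>The output gate must have number \<open>0\<close>. Its repetition does no harm,
    because the network addresses gates by index.\<close>
  then have "set (Y Rej # gs) = gate_set \<and> Y Rej # gs \<noteq> [] \<and> (Y Rej # gs) ! 0 = Y Rej"
    by (simp add: insert_absorb gate_set_iff cell_set_iff)
  then have "set gates = gate_set \<and> gates \<noteq> [] \<and> gates ! 0 = Y Rej"
    unfolding gates_def by (rule someI)
  then show "set gates = gate_set" "gates \<noteq> []" "gates ! 0 = Y Rej" by blast+
qed

abbreviation "gate_link d g g' \<equiv> linked d (gates ! g) (gates ! g')"

lemma ex_gate: "g \<in> gate_set \<longleftrightarrow> (\<exists>n<length gates. gates ! n = g)"
  using gates(1) by (metis in_set_conv_nth)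

lemma network_gates: "L > 0 \<Longrightarrow> network L (length gates) gate_link"
proof unfold_locales
  show "\<exists>g'<length gates. gate_link 1 g g'" if "g < length gates" for g
    using linked_total[of "gates ! g"] that ex_gate by metis
qed (use gates(2) in auto)

context
  fixes x :: "bool list" and L :: nat
  assumes L: "L > 0" and wf: "wf_tm M"
begin

interpretation network L "length gates" gate_link "\<lambda>i g. input_gate (input_at x i) (gates ! g)"
  by (rule network_gates[OF L])

text \<open>
  The missing neighbour at the right end corrupts one more position in each step, whence the
  condition \<open>i + t < L\<close>; at position \<open>0\<close> the left neighbour is irrelevant.
\<close>

lemma gate_val_evolve:
  "i + t < L \<Longrightarrow> g < length gates \<Longrightarrow> gates ! g = Y s \<Longrightarrow>
    gate_val (2 * t) i g \<longleftrightarrow> evolve x t i \<noteq> s"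
proof (induction t arbitrary: i g s)
  case 0
  then show ?case by (simp only: mult_0_right gate_val.simps evolve.simps) (simp add: input_gate_def)
next
  case (Suc t)
  \<comment> \<open>The left content is unconstrained at position \<open>0\<close>, where that input
    is missing.\<close>
  let ?P = "\<lambda>a b c. (i > 0 \<longrightarrow> evolve x t (i - 1) = a) \<and> evolve x t i = b \<and> evolve x t (Suc i) = c"
  have zval: "gate_val (Suc (2 * t)) i g \<longleftrightarrow> ?P a b c"
    if g: "g < length gates" "gates ! g = Z a b c" for g a b c
  proof -
    have "Z a b c \<in> gate_set" using g ex_gate by blast
    then obtain na nb nc where n: "na < length gates" "gates ! na = Y a" "nb < length gates" "gates ! nb = Y b"
        "nc < length gates" "gates ! nc = Y c"
      using ex_gate gate_set_iff by metis
    have edge_iff: "edge i g i' g' \<longleftrightarrow> Suc i' = i \<and> gates ! g' = Y a \<or> i' = i \<and> gates ! g' = Y b \<or>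
        i' = Suc i \<and> gates ! g' = Y c" for i' g'
    proof (cases "gates ! g'")
      case (Y s)
      then show ?thesis by (auto simp: edge_def g)
    qed (auto simp: edge_def g)
    \<comment> \<open>The position grows by at most one while the time drops by one, so the sum
      stays below \<open>L\<close>.\<close>
    have IH: "gate_val (2 * t) i' g' \<longleftrightarrow> evolve x t i' \<noteq> s"
      if "g' < length gates" "gates ! g' = Y s" "i' \<le> Suc i" for i' g' s
      using Suc.IH[of i' g' s] Suc.prems(1) that by simp
    show ?thesis
    proof
      assume v: "gate_val (Suc (2 * t)) i g"
      have neg: "\<not> gate_val (2 * t) i' g'" if "edge i g i' g'" "i' < L" "g' < length gates" for i' g'
        using v that by simp
      have "evolve x t (i - 1) = a" if "i > 0"
      proof -
        have "edge i g (i - 1) na" using edge_iff n(2) that by simp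
        then show ?thesis using neg IH[OF n(1,2), of "i - 1"] n(1) Suc.prems(1) by simp
      qed
      moreover have "evolve x t i = b"
      proof -
        have "edge i g i nb" using edge_iff n(4) by simp
        then show ?thesis using neg IH[OF n(3,4), of i] n(3) Suc.prems(1) by simp
      qed
      moreover have "evolve x t (Suc i) = c"
      proof -
        have "edge i g (Suc i) nc" using edge_iff n(6) by simp
        then show ?thesis using neg IH[OF n(5,6), of "Suc i"] n(5) Suc.prems(1) by simp
      qed
      ultimately show "(i > 0 \<longrightarrow> evolve x t (i - 1) = a) \<and> evolve x t i = b \<and> evolve x t (Suc i) = c" by blast
    next
      assume "(i > 0 \<longrightarrow> evolve x t (i - 1) = a) \<and> evolve x t i = b \<and> evolve x t (Suc i) = c"
      then show "gate_val (Suc (2 * t)) i g"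
        unfolding gate_val.simps edge_iff by (auto simp: IH)
    qed
  qed
  have edge_iff: "edge i g i' g' \<longleftrightarrow> i' = i \<and> (\<exists>a b c. gates ! g' = Z a b c \<and> next_cell a b c = s)" for i' g'
    by (cases "gates ! g'") (auto simp: edge_def Suc.prems(3))
  have i: "i < L" using Suc.prems(1) by simp
  have "gate_val (2 * Suc t) i g \<longleftrightarrow>
      \<not> (\<exists>g'<length gates. \<exists>a b c. gates ! g' = Z a b c \<and> next_cell a b c = s \<and> gate_val (Suc (2 * t)) i g')"
    using i unfolding mult_Suc_right add_2_eq_Suc gate_val.simps(2)[of "Suc (2 * t)"] edge_iff by blast
  also have "\<dots> \<longleftrightarrow> \<not> (\<exists>a b c. Z a b c \<in> gate_set \<and> next_cell a b c = s \<and> ?P a b c)"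
  proof (intro arg_cong[where f = Not] iffI)
    assume "\<exists>g'<length gates. \<exists>a b c. gates ! g' = Z a b c \<and> next_cell a b c = s \<and> gate_val (Suc (2 * t)) i g'"
    then obtain g' a b c where g': "g' < length gates" "gates ! g' = Z a b c" "next_cell a b c = s"
        "gate_val (Suc (2 * t)) i g'"
      by blast
    have "Z a b c \<in> gate_set" using g' ex_gate by blast
    moreover have "?P a b c" using g'(4) unfolding zval[OF g'(1,2)] .
    ultimately show "\<exists>a b c. Z a b c \<in> gate_set \<and> next_cell a b c = s \<and> ?P a b c"
      using g'(3) by (intro exI conjI) blast+
  next
    assume "\<exists>a b c. Z a b c \<in> gate_set \<and> next_cell a b c = s \<and> ?P a b c"
    then obtain a b c where abc: "Z a b c \<in> gate_set" "next_cell a b c = s" "?P a b c"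
      by blast
    obtain g' where g': "g' < length gates" "gates ! g' = Z a b c" using abc(1) ex_gate by blast
    have "gate_val (Suc (2 * t)) i g'" using abc(3) unfolding zval[OF g'] .
    then show "\<exists>g'<length gates. \<exists>a b c. gates ! g' = Z a b c \<and> next_cell a b c = s \<and> gate_val (Suc (2 * t)) i g'"
      using g' abc(2) by (intro exI conjI)
  qed
  also have "\<dots> \<longleftrightarrow> evolve x (Suc t) i \<noteq> s"
  proof (cases "i = 0")
    case True
    \<comment> \<open>All gates that are true here agree on the next content; \<open>Wall\<close>
      supplies a left content for which such a gate exists.\<close>
    have "next_cell a (evolve x t 0) (evolve x t (Suc 0)) = evolve x (Suc t) 0" for a
      using next_cell_0[OF evolve_0] evolve_pos[of "Suc 0" x t] by (metis evolve.simps(2) insertCI zero_less_Suc)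
    then show ?thesis
      using evolve_closed[OF wf] cell_set_iff(1) by (auto simp: True gate_set_iff simp del: evolve.simps)
  next
    case False
    then show ?thesis using evolve_closed[OF wf] by (auto simp: gate_set_iff)
  qed
  finally show ?case .
qed

end

end

section \<open>A program for the reduction\<close>

lemma list_update_numeral: "(y # ys)[numeral v := z] = y # ys[pred_numeral v := z]"
  by (simp add: numeral_eq_Suc)

lemma exec_Seq:
  "exec x B a s os1 s1 \<Longrightarrow> exec x B b s1 os2 s2 \<Longrightarrow> os = os1 @ os2 \<Longrightarrow> exec x B (Seq a b) s os s2"
  by (auto intro: exec.Seq)

text \<open>\<open>C k\<close> is the state before test number \<open>k\<close>. The body starts one
  lower in \<open>v\<close> because the test itself decrements.\<close>

lemma exec_While:
  assumes "\<And>k. k \<le> n \<Longrightarrow> v < length (C k) \<and> C k ! v = n - k"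
    and "\<And>k. k < n \<Longrightarrow> exec x B b ((C k)[v := n - Suc k], h k) (f k) (C (Suc k), h (Suc k))"
    and "s = (C 0, h 0)" "s' = (C n, h n)" "os = concat (map f [0..<n])"
  shows "exec x B (While v b) s os s'"
proof -
  have "exec x B (While v b) (C k, h k) (concat (map f [k..<n])) (C n, h n)" if "k \<le> n" for k
    using that
  proof (induction k rule: inc_induct)
    case base
    then show ?case using assms(1)[of n] by (auto intro: exec.While_0)
  next
    case (step k)
    have "exec x B (While v b) (C k, h k) (f k @ concat (map f [Suc k..<n])) (C n, h n)"
      by (rule exec.While_Suc[where n = "n - Suc k"]) (use assms(1)[of k] assms(2)[of k] step in auto)
    then show ?case using step by (simp add: upt_conv_Cons)
  qed
  from this[of 0] show ?thesis using assms(3-5) by simp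
qed

text \<open>A plain loop consumes its counter. Here each unit is moved to the scratch counter
  \<open>t\<close> and moved back afterwards, so \<open>v\<close> survives.\<close>

definition Repeat :: "nat \<Rightarrow> nat \<Rightarrow> com \<Rightarrow> com" where
  "Repeat v t b = Seq (While v (Seq (Inc t) b)) (While t (Inc v))"

text \<open>\<open>C k\<close> describes the state as if \<open>v\<close> and \<open>t\<close> still
  had their initial values; the true values inside the body are patched in by the two
  updates.\<close>

lemma exec_Repeat:
  assumes "v \<noteq> t" "n \<le> B"
    and C: "\<And>k. k \<le> n \<Longrightarrow> v < length (C k) \<and> t < length (C k) \<and> C k ! v = n \<and> C k ! t = 0"
    and body: "\<And>k. k < n \<Longrightarrow> exec x B b ((C k)[v := n - Suc k, t := Suc k], h) (f k)
      ((C (Suc k))[v := n - Suc k, t := Suc k], h)"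
    and "s = (C 0, h)" "s' = (C n, h)" "os = concat (map f [0..<n])"
  shows "exec x B (Repeat v t b) s os s'"
  unfolding Repeat_def
proof (rule exec_Seq)
  show "exec x B (While v (Seq (Inc t) b)) s os ((C n)[v := 0, t := n], h)"
  proof (rule exec_While[where C = "\<lambda>k. (C k)[v := n - k, t := k]" and n = n and h = "\<lambda>_. h" and f = f])
    show "s = ((C 0)[v := n - 0, t := 0], h)"
      using C[of 0] list_update_id[of "C 0" v] list_update_id[of "C 0" t] assms(5) by simp
    show "exec x B (Seq (Inc t) b) (((C k)[v := n - k, t := k])[v := n - Suc k], h) (f k)
        ((C (Suc k))[v := n - Suc k, t := Suc k], h)" if "k < n" for k
    proof (rule exec_Seq)
      have "((C k)[v := n - k, t := k])[v := n - Suc k] = (C k)[v := n - Suc k, t := k]"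
        using assms(1) by (simp add: list_update_swap)
      then show "exec x B (Inc t) (((C k)[v := n - k, t := k])[v := n - Suc k], h) []
          ((C k)[v := n - Suc k, t := Suc k], h)"
        using exec.Inc[of t "(C k)[v := n - Suc k, t := k]" B x h] C[of k] assms(1,2) that by simp
    qed (use body[OF that] in auto)
  qed (use C assms in auto)
  show "exec x B (While t (Inc v)) ((C n)[v := 0, t := n], h) [] s'"
  proof (rule exec_While[where C = "\<lambda>k. (C n)[v := k, t := n - k]" and n = n and h = "\<lambda>_. h" and f = "\<lambda>_. []"])
    show "s' = ((C n)[v := n, t := n - n], h)"
      using C[of n] list_update_id[of "C n" v] list_update_id[of "C n" t] assms(6) by simp
    show "exec x B (Inc v) (((C n)[v := k, t := n - k])[t := n - Suc k], h) []
        ((C n)[v := Suc k, t := n - Suc k], h)" if "k < n" for k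
      using exec.Inc[of v "(C n)[v := k, t := n - Suc k]" B x h] C[of n] assms(1,2) that
      by (simp add: list_update_swap)
  qed (use C assms in \<open>auto simp: map_replicate_const\<close>)
qed (use assms(7) in simp)

lemma exec_Repeat_const:
  assumes "v \<noteq> t" "n \<le> B" "v < length C" "t < length C" "C ! v = n" "C ! t = 0"
    and "\<And>k. k < n \<Longrightarrow> exec x B b (C[v := n - Suc k, t := Suc k], h) bs (C[v := n - Suc k, t := Suc k], h)"
    and "os = concat (replicate n bs)"
  shows "exec x B (Repeat v t b) (C, h) os (C, h)"
  by (rule exec_Repeat[where C = "\<lambda>_. C" and n = n and f = "\<lambda>_. bs"])
    (use assms in \<open>auto simp: map_replicate_const\<close>)

primrec outs :: "(input_symbol \<Rightarrow> bool) list \<Rightarrow> com" where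
  "outs [] = com.Skip"
| "outs (f # fs) = Seq (Out f) (outs fs)"

lemma exec_outs: "exec x B (outs fs) (C, h) (map (\<lambda>f. f (input_at x h)) fs) (C, h)"
  by (induction fs) (auto intro: exec.Skip intro!: exec_Seq exec.Out)

definition emit :: "bool list \<Rightarrow> com" where
  "emit bs = outs (map (\<lambda>b _. b) bs)"

lemma exec_emit: "exec x B (emit bs) (C, h) bs (C, h)"
  using exec_outs[of x B "map (\<lambda>b _. b) bs" C h] by (simp add: emit_def o_def)

primrec incs :: "nat \<Rightarrow> nat \<Rightarrow> com" where
  "incs v 0 = com.Skip"
| "incs v (Suc k) = Seq (Inc v) (incs v k)"

lemma exec_incs: "v < length C \<Longrightarrow> C ! v + k \<le> B \<Longrightarrow> exec x B (incs v k) (C, h) [] (C[v := C ! v + k], h)"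
proof (induction k arbitrary: C)
  case 0
  then show ?case by (auto intro: exec.Skip)
next
  case (Suc k)
  have "exec x B (Inc v) (C, h) [] (C[v := Suc (C ! v)], h)" using Suc.prems by (intro exec.Inc) auto
  moreover have "exec x B (incs v k) (C[v := Suc (C ! v)], h) [] (C[v := C ! v + Suc k], h)"
    using Suc.IH[of "C[v := Suc (C ! v)]"] Suc.prems by simp
  ultimately show ?case by (auto intro: exec_Seq)
qed

lemma exec_seqs:
  assumes "\<And>g. g \<in> set gs \<Longrightarrow> exec x B (c g) s (f g) s"
  shows "exec x B (foldr (\<lambda>g. Seq (c g)) gs com.Skip) s (concat (map f gs)) s"
  using assms by (induction gs) (auto intro: exec.Skip intro!: exec_Seq)

text \<open>
  The counters are: \<open>0\<close> the base of the power, \<open>1\<close> the number \<open>L\<close> of levels, \<open>4\<close> the current level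
  and \<open>2\<close> the number of levels below it, \<open>5\<close> the current position and \<open>3\<close> the number of positions
  after it, \<open>6\<close> and \<open>7\<close> auxiliary counters of loops.
\<close>

definition read_length :: "nat \<Rightarrow> com" where
  "read_length c = Seq (WhileIn (\<lambda>s. s \<noteq> Right_End) (Seq (Inc 0) (Move Rgt)))
     (Seq (WhileIn (\<lambda>s. s \<noteq> Left_End) (Move Lft)) (incs 0 c))"

lemma input_at_Right_End: "input_at x h = Right_End \<longleftrightarrow> h > length x"
  and input_at_Left_End: "input_at x h = Left_End \<longleftrightarrow> h = 0"
  by (auto simp: input_at_def)

lemma exec_read_length:
  assumes "length x + 1 + c \<le> B"
  shows "exec x B (read_length c) (0 # C, 0) [] ((length x + 1 + c) # C, 0)"
proof -
  let ?n = "Suc (length x)"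
  \<comment> \<open>The left end marker is counted as well, which gives
    \<open>Suc (length x)\<close> and makes the base of the power positive.\<close>
  have 1: "exec x B (WhileIn (\<lambda>s. s \<noteq> Right_End) (Seq (Inc 0) (Move Rgt))) (k # C, k) [] (?n # C, ?n)"
    if "k \<le> ?n" for k
    using that
  proof (induction k rule: inc_induct)
    case base
    show ?case by (rule exec.WhileIn_stop) (simp add: input_at_Right_End)
  next
    case (step k)
    have "exec x B (Inc 0) (k # C, k) [] (Suc k # C, k)"
      using exec.Inc[of 0 "k # C" B x k] step assms by simp
    moreover have "exec x B (Move Rgt) (Suc k # C, k) [] (Suc k # C, Suc k)"
      using exec.Move[of x B Rgt "Suc k # C" k] step by (simp add: min_def)
    ultimately have "exec x B (Seq (Inc 0) (Move Rgt)) (k # C, k) [] (Suc k # C, Suc k)"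
      by (auto intro: exec_Seq)
    then show ?case
      using exec.WhileIn_step[of "\<lambda>s. s \<noteq> Right_End" x k, OF _ _ step(3)] step(2)
      by (fastforce simp: input_at_Right_End)
  qed
  have 2: "exec x B (WhileIn (\<lambda>s. s \<noteq> Left_End) (Move Lft)) (D, h) [] (D, 0)"
    if "h \<le> ?n" for D h
    using that
  proof (induction h)
    case 0
    show ?case by (rule exec.WhileIn_stop) (simp add: input_at_Left_End)
  next
    case (Suc h)
    have "exec x B (Move Lft) (D, Suc h) [] (D, h)"
      using exec.Move[of x B Lft D "Suc h"] Suc.prems by (simp add: min_def)
    then show ?case
      using exec.WhileIn_step[of "\<lambda>s. s \<noteq> Left_End" x "Suc h", OF _ _ Suc.IH] Suc.prems
      by (fastforce simp: input_at_Left_End)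
  qed
  have 3: "exec x B (incs 0 c) (?n # C, 0) [] ((length x + 1 + c) # C, 0)"
    using exec_incs[of 0 "?n # C" c B x 0] assms by simp
  show ?thesis
    unfolding read_length_def using 1[of 0] 2[of ?n "?n # C"] 3
    by (auto intro!: exec_Seq[where ?os1.0 = "[]" and ?os2.0 = "[]"])
qed

section \<open>Arithmetic on the counters\<close>

definition mult_step :: com where
  "mult_step = Seq (While 1 (Repeat 0 6 (Inc 5))) (While 5 (Inc 1))"

lemma exec_mult_step:
  assumes "p * a \<le> B" "a \<le> B"
  shows "exec x B mult_step ([a, p, 0, 0, 0, 0, 0, 0], h) [] ([a, p * a, 0, 0, 0, 0, 0, 0], h)"
  unfolding mult_step_def
proof (rule exec_Seq)
  show "exec x B (While 1 (Repeat 0 6 (Inc 5))) ([a, p, 0, 0, 0, 0, 0, 0], h) [] ([a, 0, 0, 0, 0, p * a, 0, 0], h)"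
  proof (rule exec_While[where C = "\<lambda>k. [a, p - k, 0, 0, 0, k * a, 0, 0]" and n = p and f = "\<lambda>_. []" and h = "\<lambda>_. h"])
    fix k assume k: "k < p"
    then have "Suc k * a \<le> p * a" by (intro mult_le_mono1) simp
    then have le: "k * a + a \<le> B" using assms(1) by simp
    have "exec x B (Repeat 0 6 (Inc 5)) ([a, p - Suc k, 0, 0, 0, k * a, 0, 0], h) []
        ([a, p - Suc k, 0, 0, 0, Suc k * a, 0, 0], h)"
    proof (rule exec_Repeat[where C = "\<lambda>j. [a, p - Suc k, 0, 0, 0, k * a + j, 0, 0]" and n = a and f = "\<lambda>_. []"])
      fix j assume j: "j < a"
      have "exec x B (Inc 5) ([a - Suc j, p - Suc k, 0, 0, 0, k * a + j, Suc j, 0], h) []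
        ([a - Suc j, p - Suc k, 0, 0, 0, Suc (k * a + j), Suc j, 0], h)"
        using exec.Inc[of 5 "[a - Suc j, p - Suc k, 0, 0, 0, k * a + j, Suc j, 0]" B x h] j le
        by (simp add: list_update_numeral)
      then show "exec x B (Inc 5) ([a, p - Suc k, 0, 0, 0, k * a + j, 0, 0][0 := a - Suc j, 6 := Suc j], h) []
        ([a, p - Suc k, 0, 0, 0, k * a + Suc j, 0, 0][0 := a - Suc j, 6 := Suc j], h)"
        by (simp add: list_update_numeral)
    qed (use assms in \<open>auto simp: map_replicate_const\<close>)
    then show "exec x B (Repeat 0 6 (Inc 5)) ([a, p - k, 0, 0, 0, k * a, 0, 0][1 := p - Suc k], h) []
        ([a, p - Suc k, 0, 0, 0, Suc k * a, 0, 0], h)"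
      by simp
  qed (auto simp: map_replicate_const)
  show "exec x B (While 5 (Inc 1)) ([a, 0, 0, 0, 0, p * a, 0, 0], h) [] ([a, p * a, 0, 0, 0, 0, 0, 0], h)"
  proof (rule exec_While[where C = "\<lambda>k. [a, k, 0, 0, 0, p * a - k, 0, 0]" and n = "p * a" and f = "\<lambda>_. []" and h = "\<lambda>_. h"])
    fix k assume "k < p * a"
    then show "exec x B (Inc 1) ([a, k, 0, 0, 0, p * a - k, 0, 0][5 := p * a - Suc k], h) []
        ([a, Suc k, 0, 0, 0, p * a - Suc k, 0, 0], h)"
      using exec.Inc[of 1 "[a, k, 0, 0, 0, p * a - Suc k, 0, 0]" B x h] assms(1)
      by (simp add: list_update_numeral)
  qed (auto simp: map_replicate_const)
qed simp

text \<open>The exponent is a constant of the reduction, so the multiplications are unrolled in the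
  program text and need no counter.\<close>

definition power_prog :: "nat \<Rightarrow> com" where
  "power_prog K = Seq (Inc 1) (foldr (\<lambda>_. Seq mult_step) [0..<K] com.Skip)"

lemma exec_power_prog:
  assumes "a > 0" "a ^ K \<le> B" "a \<le> B"
  shows "exec x B (power_prog K) ([a, 0, 0, 0, 0, 0, 0, 0], h) [] ([a, a ^ K, 0, 0, 0, 0, 0, 0], h)"
proof -
  have "exec x B (foldr (\<lambda>_. Seq mult_step) [k..<K] com.Skip) ([a, a ^ k, 0, 0, 0, 0, 0, 0], h) []
      ([a, a ^ K, 0, 0, 0, 0, 0, 0], h)" if "k \<le> K" for k
    using that
  proof (induction k rule: inc_induct)
    case base
    show ?case by (auto intro: exec.Skip)
  next
    case (step k)
    have "a ^ Suc k \<le> a ^ K" using assms(1) step by (intro power_increasing) auto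
    then have "exec x B mult_step ([a, a ^ k, 0, 0, 0, 0, 0, 0], h) [] ([a, a ^ Suc k, 0, 0, 0, 0, 0, 0], h)"
      using exec_mult_step[of "a ^ k" a B x h] assms by (simp add: mult.commute)
    then show ?case using step by (auto simp: upt_conv_Cons intro: exec_Seq)
  qed
  from this[of 0] show ?thesis
    unfolding power_prog_def
    using exec.Inc[of 1 "[a, 0, 0, 0, 0, 0, 0, 0]" B x h] assms by (auto intro!: exec_Seq)
qed

definition height_prog :: com where
  "height_prog = While 1 (incs 2 2)"

lemma exec_height_prog:
  assumes "2 * p \<le> B"
  shows "exec x B height_prog ([a, p, 0, 0, 0, 0, 0, 0], h) [] ([a, 0, 2 * p, 0, 0, 0, 0, 0], h)"
  unfolding height_prog_def
proof (rule exec_While[where C = "\<lambda>k. [a, p - k, 2 * k, 0, 0, 0, 0, 0]" and n = p and f = "\<lambda>_. []" and h = "\<lambda>_. h"])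
  fix k assume "k < p"
  then show "exec x B (incs 2 2) ([a, p - k, 2 * k, 0, 0, 0, 0, 0][1 := p - Suc k], h) []
      ([a, p - Suc k, 2 * Suc k, 0, 0, 0, 0, 0], h)"
    using exec_incs[of 2 "[a, p - Suc k, 2 * k, 0, 0, 0, 0, 0]" 2 B x h] assms
    by (simp add: list_update_numeral)
qed (auto simp: map_replicate_const)

section \<open>Writing the formula\<close>

definition formula_prog :: com where
  "formula_prog =
     Seq (Repeat 2 6 (emit [True, False, False]))
    (Seq (emit (enc_fm (Var 0)))
         (Repeat 2 6 (Seq (Repeat 4 7 (emit ([True, False, False] @ enc_fm (Imp Bot Bot))))
                     (Seq (emit [False, False, False]) (Inc 4)))))"

lemma enc_rank_fm: "enc_fm (rank_fm k) =
  concat (replicate k ([True, False, False] @ enc_fm (Imp Bot Bot))) @ [False, False, False]"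
  by (induction k) auto

lemma concat_replicate_append: "concat (replicate n xs) @ xs = xs @ concat (replicate n xs)"
  by (induction n) auto

text \<open>The formula nests to the left, so in prefix notation all implication symbols come first
  and the conclusions follow in increasing order. Two nested loops can write it without
  recursion.\<close>

lemma enc_nor_fm: "enc_fm (nor_fm k) =
  concat (replicate k [True, False, False]) @ enc_fm (Var 0) @ concat (map (\<lambda>i. enc_fm (rank_fm i)) [0..<k])"
  by (induction k) (auto simp del: enc_fm.simps(2))

lemma exec_formula_prog:
  assumes "n \<le> B"
  shows "exec x B formula_prog ([a, 0, n, 0, 0, 0, 0, 0], h) (enc_fm (nor_fm n)) ([a, 0, n, 0, n, 0, 0, 0], h)"
  unfolding formula_prog_def enc_nor_fm
proof (intro exec_Seq[OF _ exec_Seq refl])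
  show "exec x B (Repeat 2 6 (emit [True, False, False])) ([a, 0, n, 0, 0, 0, 0, 0], h)
      (concat (replicate n [True, False, False])) ([a, 0, n, 0, 0, 0, 0, 0], h)"
    by (rule exec_Repeat_const[where n = n]) (use assms in \<open>auto intro: exec_emit\<close>)
  show "exec x B (emit (enc_fm (Var 0))) ([a, 0, n, 0, 0, 0, 0, 0], h) (enc_fm (Var 0)) ([a, 0, n, 0, 0, 0, 0, 0], h)"
    by (rule exec_emit)
  show "exec x B (Repeat 2 6 (Seq (Repeat 4 7 (emit ([True, False, False] @ enc_fm (Imp Bot Bot))))
      (Seq (emit [False, False, False]) (Inc 4)))) ([a, 0, n, 0, 0, 0, 0, 0], h)
      (concat (map (\<lambda>i. enc_fm (rank_fm i)) [0..<n])) ([a, 0, n, 0, n, 0, 0, 0], h)"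
  proof (rule exec_Repeat[where C = "\<lambda>k. [a, 0, n, 0, k, 0, 0, 0]" and n = n])
    fix k assume k: "k < n"
    let ?C = "\<lambda>l. [a, 0, n - Suc k, 0, l, 0, Suc k, 0]"
    have 1: "exec x B (Repeat 4 7 (emit ([True, False, False] @ enc_fm (Imp Bot Bot)))) (?C k, h)
        (concat (replicate k ([True, False, False] @ enc_fm (Imp Bot Bot)))) (?C k, h)"
      by (rule exec_Repeat_const[where n = k]) (use assms k in \<open>auto intro: exec_emit\<close>)
    have 2: "exec x B (Inc 4) (?C k, h) [] (?C (Suc k), h)"
      using exec.Inc[of 4 "?C k" B x h] k assms by (simp add: list_update_numeral)
    have "exec x B (Seq (Repeat 4 7 (emit ([True, False, False] @ enc_fm (Imp Bot Bot))))
      (Seq (emit [False, False, False]) (Inc 4))) (?C k, h) (enc_fm (rank_fm k)) (?C (Suc k), h)"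
      by (rule exec_Seq[OF 1 exec_Seq[OF exec_emit 2 refl]]) (simp add: enc_rank_fm)
    then show "exec x B (Seq (Repeat 4 7 (emit ([True, False, False] @ enc_fm (Imp Bot Bot))))
      (Seq (emit [False, False, False]) (Inc 4))) ([a, 0, n, 0, k, 0, 0, 0][2 := n - Suc k, 6 := Suc k], h)
      (enc_fm (rank_fm k)) ([a, 0, n, 0, Suc k, 0, 0, 0][2 := n - Suc k, 6 := Suc k], h)"
      by (simp add: list_update_numeral)
  qed (use assms in auto)
qed (rule refl)

text \<open>The loop before has left a second copy of the height in counter \<open>4\<close>. The
  number of levels is one more than the height.\<close>

definition setup_prog :: com where
  "setup_prog = Seq (Inc 4) (Seq (Inc 2) (While 4 (Seq (Inc 3) (Inc 1))))"

lemma exec_setup_prog: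
  assumes "n < B"
  shows "exec x B setup_prog ([a, 0, n, 0, n, 0, 0, 0], h) [] ([a, Suc n, Suc n, Suc n, 0, 0, 0, 0], h)"
proof -
  have 1: "exec x B (Inc 4) ([a, 0, n, 0, n, 0, 0, 0], h) [] ([a, 0, n, 0, Suc n, 0, 0, 0], h)"
    using exec.Inc[of 4 "[a, 0, n, 0, n, 0, 0, 0]" B x h] assms by (simp add: list_update_numeral)
  have 2: "exec x B (Inc 2) ([a, 0, n, 0, Suc n, 0, 0, 0], h) [] ([a, 0, Suc n, 0, Suc n, 0, 0, 0], h)"
    using exec.Inc[of 2 "[a, 0, n, 0, Suc n, 0, 0, 0]" B x h] assms by (simp add: list_update_numeral)
  have 3: "exec x B (While 4 (Seq (Inc 3) (Inc 1))) ([a, 0, Suc n, 0, Suc n, 0, 0, 0], h) []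
      ([a, Suc n, Suc n, Suc n, 0, 0, 0, 0], h)"
  proof (rule exec_While[where C = "\<lambda>k. [a, k, Suc n, k, Suc n - k, 0, 0, 0]" and n = "Suc n" and f = "\<lambda>_. []" and h = "\<lambda>_. h"])
    fix k assume k: "k < Suc n"
    have 1: "exec x B (Inc 3) ([a, k, Suc n, k, n - k, 0, 0, 0], h) [] ([a, k, Suc n, Suc k, n - k, 0, 0, 0], h)"
      using exec.Inc[of 3 "[a, k, Suc n, k, n - k, 0, 0, 0]" B x h] assms k by (simp add: list_update_numeral)
    have 2: "exec x B (Inc 1) ([a, k, Suc n, Suc k, n - k, 0, 0, 0], h) [] ([a, Suc k, Suc n, Suc k, n - k, 0, 0, 0], h)"
      using exec.Inc[of 1 "[a, k, Suc n, Suc k, n - k, 0, 0, 0]" B x h] assms k by simp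
    show "exec x B (Seq (Inc 3) (Inc 1)) ([a, k, Suc n, k, Suc n - k, 0, 0, 0][4 := Suc n - Suc k], h) []
        ([a, Suc k, Suc n, Suc k, Suc n - Suc k, 0, 0, 0], h)"
      using exec_Seq[OF 1 2 refl] by (simp add: list_update_numeral)
  qed (auto simp: map_replicate_const)
  show ?thesis
    unfolding setup_prog_def using exec_Seq[OF 1 exec_Seq[OF 2 3 refl] refl] by simp
qed

section \<open>Writing the adjacency matrix and the valuation\<close>

definition block_prog :: "nat \<Rightarrow> bool \<Rightarrow> com" where
  "block_prog G b = Repeat 1 7 (emit (replicate G b))"

definition block :: "nat \<Rightarrow> nat \<Rightarrow> bool \<Rightarrow> bool list" where
  "block G n b = concat (replicate n (replicate G b))"

lemma exec_block_prog:
  "n \<le> B \<Longrightarrow> exec x B (block_prog G b) ([a, n, m, j, l, i, s, 0], h) (block G n b) ([a, n, m, j, l, i, s, 0], h)"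
  unfolding block_prog_def block_def
  by (rule exec_Repeat_const[where n = n]) (auto intro: exec_emit)

text \<open>The decrement in \<open>Cond\<close> is put to use: counter \<open>5\<close> then holds
  the number of positions left of the left neighbour, and counter \<open>3\<close> the number right
  of the right one. \<open>Inc\<close> restores them.\<close>

definition neighbours_prog :: "nat \<Rightarrow> (nat \<Rightarrow> bool list) \<Rightarrow> com" where
  "neighbours_prog G e =
     Seq (Cond 5 (Seq (Repeat 5 6 (emit (replicate G False))) (Seq (emit (e 0)) (Inc 5))) com.Skip)
    (Seq (emit (e 1))
         (Cond 3 (Seq (emit (e 2)) (Seq (Repeat 3 6 (emit (replicate G False))) (Inc 3))) com.Skip))"

definition neighbours :: "nat \<Rightarrow> (nat \<Rightarrow> bool list) \<Rightarrow> nat \<Rightarrow> nat \<Rightarrow> bool list" where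
  "neighbours G e i j =
     (if i = 0 then [] else block G (i - 1) False @ e 0) @ e 1 @
     (if j = 0 then [] else e 2 @ block G (j - 1) False)"

lemma exec_neighbours_prog:
  assumes "i \<le> B" "j \<le> B"
  shows "exec x B (neighbours_prog G e) ([a, n, m, j, l, i, 0, 0], h) (neighbours G e i j) ([a, n, m, j, l, i, 0, 0], h)"
  unfolding neighbours_prog_def neighbours_def
proof (intro exec_Seq[OF _ exec_Seq refl])
  show "exec x B (Cond 5 (Seq (Repeat 5 6 (emit (replicate G False))) (Seq (emit (e 0)) (Inc 5))) com.Skip)
      ([a, n, m, j, l, i, 0, 0], h) (if i = 0 then [] else block G (i - 1) False @ e 0) ([a, n, m, j, l, i, 0, 0], h)"
  proof (cases i)
    case 0
    then show ?thesis by (auto intro!: exec.Cond_0 exec.Skip)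
  next
    case (Suc k)
    have 1: "exec x B (Repeat 5 6 (emit (replicate G False))) ([a, n, m, j, l, k, 0, 0], h)
        (block G k False) ([a, n, m, j, l, k, 0, 0], h)"
      unfolding block_def by (rule exec_Repeat_const[where n = k]) (use Suc assms in \<open>auto intro: exec_emit\<close>)
    have 2: "exec x B (Inc 5) ([a, n, m, j, l, k, 0, 0], h) [] ([a, n, m, j, l, i, 0, 0], h)"
      using exec.Inc[of 5 "[a, n, m, j, l, k, 0, 0]" B x h] Suc assms by (simp add: list_update_numeral)
    show ?thesis
      using exec_Seq[OF 1 exec_Seq[OF exec_emit 2 refl] refl, of "e 0"] Suc
      by (auto intro!: exec.Cond_Suc simp: list_update_numeral)
  qed
  show "exec x B (Cond 3 (Seq (emit (e 2)) (Seq (Repeat 3 6 (emit (replicate G False))) (Inc 3))) com.Skip)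
      ([a, n, m, j, l, i, 0, 0], h) (if j = 0 then [] else e 2 @ block G (j - 1) False) ([a, n, m, j, l, i, 0, 0], h)"
  proof (cases j)
    case 0
    then show ?thesis by (auto intro!: exec.Cond_0 exec.Skip)
  next
    case (Suc k)
    have 1: "exec x B (Repeat 3 6 (emit (replicate G False))) ([a, n, m, k, l, i, 0, 0], h)
        (block G k False) ([a, n, m, k, l, i, 0, 0], h)"
      unfolding block_def by (rule exec_Repeat_const[where n = k]) (use Suc assms in \<open>auto intro: exec_emit\<close>)
    have 2: "exec x B (Inc 3) ([a, n, m, k, l, i, 0, 0], h) [] ([a, n, m, j, l, i, 0, 0], h)"
      using exec.Inc[of 3 "[a, n, m, k, l, i, 0, 0]" B x h] Suc assms by (simp add: list_update_numeral)
    show ?thesis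
      using exec_Seq[OF exec_emit exec_Seq[OF 1 2 refl] refl, of "e 2"] Suc
      by (auto intro!: exec.Cond_Suc simp: list_update_numeral)
  qed
qed (rule exec_emit refl)+

text \<open>A row has three zones: the levels down to its own are unrelated, the next one carries
  the wiring, and all deeper ones are fully related.\<close>

definition row_prog :: "nat \<Rightarrow> (nat \<Rightarrow> bool list) \<Rightarrow> com" where
  "row_prog G e =
     Seq (Repeat 4 6 (block_prog G False))
    (Seq (block_prog G False)
         (Cond 2 (Seq (neighbours_prog G e) (Seq (Repeat 2 6 (block_prog G True)) (Inc 2))) com.Skip))"

definition row :: "nat \<Rightarrow> (nat \<Rightarrow> bool list) \<Rightarrow> nat \<Rightarrow> nat \<Rightarrow> nat \<Rightarrow> nat \<Rightarrow> nat \<Rightarrow> bool list" where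
  "row G e n l m i j =
     concat (replicate l (block G n False)) @ block G n False @
     (if m = 0 then [] else neighbours G e i j @ concat (replicate (m - 1) (block G n True)))"

lemma exec_row_prog:
  assumes "n \<le> B" "i \<le> B" "j \<le> B" "l \<le> B" "m \<le> B"
  shows "exec x B (row_prog G e) ([a, n, m, j, l, i, 0, 0], h) (row G e n l m i j) ([a, n, m, j, l, i, 0, 0], h)"
  unfolding row_prog_def row_def
proof (intro exec_Seq[OF _ exec_Seq refl])
  show "exec x B (Repeat 4 6 (block_prog G False)) ([a, n, m, j, l, i, 0, 0], h)
      (concat (replicate l (block G n False))) ([a, n, m, j, l, i, 0, 0], h)"
    by (rule exec_Repeat_const[where n = l])
      (use assms in \<open>auto simp: list_update_numeral intro: exec_block_prog\<close>)
  show "exec x B (Cond 2 (Seq (neighbours_prog G e) (Seq (Repeat 2 6 (block_prog G True)) (Inc 2))) com.Skip)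
      ([a, n, m, j, l, i, 0, 0], h)
      (if m = 0 then [] else neighbours G e i j @ concat (replicate (m - 1) (block G n True)))
      ([a, n, m, j, l, i, 0, 0], h)"
  proof (cases m)
    case 0
    then show ?thesis by (auto intro!: exec.Cond_0 exec.Skip)
  next
    case (Suc k)
    have 1: "exec x B (Repeat 2 6 (block_prog G True)) ([a, n, k, j, l, i, 0, 0], h)
        (concat (replicate k (block G n True))) ([a, n, k, j, l, i, 0, 0], h)"
      by (rule exec_Repeat_const[where n = k])
        (use Suc assms in \<open>auto simp: list_update_numeral intro: exec_block_prog\<close>)
    have 2: "exec x B (Inc 2) ([a, n, k, j, l, i, 0, 0], h) [] ([a, n, m, j, l, i, 0, 0], h)"
      using exec.Inc[of 2 "[a, n, k, j, l, i, 0, 0]" B x h] Suc assms by (simp add: list_update_numeral)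
    show ?thesis
      using exec_Seq[OF exec_neighbours_prog[OF assms(2,3)] exec_Seq[OF 1 2 refl] refl, of G e] Suc
      by (auto intro!: exec.Cond_Suc simp: list_update_numeral)
  qed
qed (use assms in \<open>auto intro: exec_block_prog\<close>)

text \<open>The gates depend on the Turing machine only, so their loop is unrolled. Counters
  \<open>2\<close> and \<open>3\<close> run down while \<open>4\<close> and \<open>5\<close> run up,
  which keeps the distances to all borders available.\<close>

definition matrix_prog :: "nat \<Rightarrow> (nat \<Rightarrow> nat \<Rightarrow> bool list) \<Rightarrow> com" where
  "matrix_prog G e =
     While 2
       (Seq (While 3 (Seq (foldr (\<lambda>g. Seq (row_prog G (e g))) [0..<G] com.Skip) (Inc 5)))
       (Seq (While 5 (Inc 3)) (Inc 4)))"

lemma exec_matrix_prog: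
  assumes "n \<le> B"
  shows "exec x B (matrix_prog G e) ([a, n, n, n, 0, 0, 0, 0], h)
    (concat (map (\<lambda>l. concat (map (\<lambda>i.
       concat (map (\<lambda>g. row G (e g) n l (n - Suc l) i (n - Suc i)) [0..<G])) [0..<n])) [0..<n]))
    ([a, n, 0, n, n, 0, 0, 0], h)"
  unfolding matrix_prog_def
proof (rule exec_While[where C = "\<lambda>l. [a, n, n - l, n, l, 0, 0, 0]" and n = n and h = "\<lambda>_. h"])
  fix l assume l: "l < n"
  let ?C = "\<lambda>i. [a, n, n - Suc l, n - i, l, i, 0, 0]"
  let ?f = "\<lambda>i. concat (map (\<lambda>g. row G (e g) n l (n - Suc l) i (n - Suc i)) [0..<G])"
  have 1: "exec x B (While 3 (Seq (foldr (\<lambda>g. Seq (row_prog G (e g))) [0..<G] com.Skip) (Inc 5))) (?C 0, h)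
      (concat (map ?f [0..<n])) (?C n, h)"
  proof (rule exec_While[where C = ?C and n = n and h = "\<lambda>_. h"])
    fix i assume i: "i < n"
    let ?D = "\<lambda>i'. [a, n, n - Suc l, n - Suc i, l, i', 0, 0]"
    have 1: "exec x B (foldr (\<lambda>g. Seq (row_prog G (e g))) [0..<G] com.Skip) (?D i, h) (?f i) (?D i, h)"
      by (intro exec_seqs exec_row_prog) (use assms l i in auto)
    have 2: "exec x B (Inc 5) (?D i, h) [] (?D (Suc i), h)"
      using exec.Inc[of 5 "?D i" B x h] i assms by (simp add: list_update_numeral)
    show "exec x B (Seq (foldr (\<lambda>g. Seq (row_prog G (e g))) [0..<G] com.Skip) (Inc 5)) ((?C i)[3 := n - Suc i], h)
        (?f i) (?C (Suc i), h)"
      using exec_Seq[OF 1 2 refl] by (simp add: list_update_numeral)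
  qed auto
  have 2: "exec x B (While 5 (Inc 3)) (?C n, h) [] ([a, n, n - Suc l, n, l, 0, 0, 0], h)"
  proof (rule exec_While[where C = "\<lambda>k. [a, n, n - Suc l, k, l, n - k, 0, 0]" and n = n and f = "\<lambda>_. []" and h = "\<lambda>_. h"])
    fix k assume "k < n"
    then show "exec x B (Inc 3) ([a, n, n - Suc l, k, l, n - k, 0, 0][5 := n - Suc k], h) []
        ([a, n, n - Suc l, Suc k, l, n - Suc k, 0, 0], h)"
      using exec.Inc[of 3 "[a, n, n - Suc l, k, l, n - Suc k, 0, 0]" B x h] assms
      by (simp add: list_update_numeral)
  qed (auto simp: map_replicate_const)
  have 3: "exec x B (Inc 4) ([a, n, n - Suc l, n, l, 0, 0, 0], h) [] ([a, n, n - Suc l, n, Suc l, 0, 0, 0], h)"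
    using exec.Inc[of 4 "[a, n, n - Suc l, n, l, 0, 0, 0]" B x h] assms l by (simp add: list_update_numeral)
  show "exec x B (Seq (While 3 (Seq (foldr (\<lambda>g. Seq (row_prog G (e g))) [0..<G] com.Skip) (Inc 5)))
      (Seq (While 5 (Inc 3)) (Inc 4))) ([a, n, n - l, n, l, 0, 0, 0][2 := n - Suc l], h)
      (concat (map ?f [0..<n])) ([a, n, n - Suc l, n, Suc l, 0, 0, 0], h)"
    using exec_Seq[OF 1 exec_Seq[OF 2 3 refl] refl] by (simp add: list_update_numeral)
qed auto

text \<open>\<open>Cond\<close> drops one level, since only the last one carries values. There
  position \<open>i\<close> needs just the input symbol at \<open>i\<close>, so the input head moves
  along.\<close>

definition values_prog :: "nat \<Rightarrow> (input_symbol \<Rightarrow> nat \<Rightarrow> bool) \<Rightarrow> com" where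
  "values_prog G f =
     Seq (Cond 4 (While 4 (Repeat 1 6 (emit (replicate G False)))) com.Skip)
         (While 3 (Seq (outs (map (\<lambda>g s. f s g) [0..<G])) (Move Rgt)))"

lemma exec_values_prog:
  assumes "n \<le> B" "n > 0"
  shows "\<exists>h. exec x B (values_prog G f) ([a, n, 0, n, n, 0, 0, 0], 0)
    (concat (replicate (n - 1) (block G n False)) @
     concat (map (\<lambda>i. map (\<lambda>g. f (input_at x i) g) [0..<G]) [0..<n]))
    ([a, n, 0, 0, 0, 0, 0, 0], h)"
proof -
  obtain k where k: "n = Suc k" using assms(2) by (cases n) auto
  have 1: "exec x B (While 4 (Repeat 1 6 (emit (replicate G False)))) ([a, n, 0, n, k, 0, 0, 0], 0)
      (concat (replicate k (block G n False))) ([a, n, 0, n, 0, 0, 0, 0], 0)"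
  proof (rule exec_While[where C = "\<lambda>l. [a, n, 0, n, k - l, 0, 0, 0]" and n = k and h = "\<lambda>_. 0" and f = "\<lambda>_. block G n False"])
    fix l assume "l < k"
    have "exec x B (Repeat 1 6 (emit (replicate G False))) ([a, n, 0, n, k - Suc l, 0, 0, 0], 0)
        (block G n False) ([a, n, 0, n, k - Suc l, 0, 0, 0], 0)"
      unfolding block_def by (rule exec_Repeat_const[where n = n]) (use assms in \<open>auto intro: exec_emit\<close>)
    then show "exec x B (Repeat 1 6 (emit (replicate G False))) ([a, n, 0, n, k - l, 0, 0, 0][4 := k - Suc l], 0)
        (block G n False) ([a, n, 0, n, k - Suc l, 0, 0, 0], 0)"
      by (simp add: list_update_numeral)
  qed (auto simp: map_replicate_const)
  have 2: "exec x B (Cond 4 (While 4 (Repeat 1 6 (emit (replicate G False)))) com.Skip) ([a, n, 0, n, n, 0, 0, 0], 0)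
      (concat (replicate k (block G n False))) ([a, n, 0, n, 0, 0, 0, 0], 0)"
    using 1 by (auto intro!: exec.Cond_Suc[where n = k] simp: k list_update_numeral)
  \<comment> \<open>The head stops at the right end marker, which \<open>input_at\<close> also
    reports for all later positions.\<close>
  let ?h = "\<lambda>i. min i (Suc (length x))"
  have 3: "exec x B (While 3 (Seq (outs (map (\<lambda>g s. f s g) [0..<G])) (Move Rgt))) ([a, n, 0, n, 0, 0, 0, 0], 0)
    (concat (map (\<lambda>i. map (\<lambda>g. f (input_at x i) g) [0..<G]) [0..<n])) ([a, n, 0, 0, 0, 0, 0, 0], ?h n)"
  proof (rule exec_While[where C = "\<lambda>i. [a, n, 0, n - i, 0, 0, 0, 0]" and n = n and h = ?h])
    fix i assume "i < n"
    have "input_at x (?h i) = input_at x i" by (auto simp: input_at_def min_def)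
    then have 1: "exec x B (outs (map (\<lambda>g s. f s g) [0..<G])) ([a, n, 0, n - Suc i, 0, 0, 0, 0], ?h i)
        (map (\<lambda>g. f (input_at x i) g) [0..<G]) ([a, n, 0, n - Suc i, 0, 0, 0, 0], ?h i)"
      using exec_outs[of x B "map (\<lambda>g s. f s g) [0..<G]" "[a, n, 0, n - Suc i, 0, 0, 0, 0]" "?h i"]
      by (simp add: o_def)
    have 2: "exec x B (Move Rgt) ([a, n, 0, n - Suc i, 0, 0, 0, 0], ?h i) [] ([a, n, 0, n - Suc i, 0, 0, 0, 0], ?h (Suc i))"
    proof -
      have "?h (Suc i) = min (apply_move Rgt (?h i)) (Suc (length x))" by (simp add: min_def)
      then show ?thesis by (simp only: exec.Move)
    qed
    show "exec x B (Seq (outs (map (\<lambda>g s. f s g) [0..<G])) (Move Rgt)) ([a, n, 0, n - i, 0, 0, 0, 0][3 := n - Suc i], ?h i)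
        (map (\<lambda>g. f (input_at x i) g) [0..<G]) ([a, n, 0, n - Suc i, 0, 0, 0, 0], ?h (Suc i))"
      using exec_Seq[OF 1 2 refl] by (simp add: list_update_numeral)
  qed auto
  show ?thesis
    unfolding values_prog_def using exec_Seq[OF 2 3 refl] by (auto simp: k)
qed

text \<open>The number of states is written in unary by nested loops and never stored, so no counter
  has to exceed the number of levels.\<close>

definition reduction_prog ::
    "nat \<Rightarrow> nat \<Rightarrow> nat \<Rightarrow> (nat \<Rightarrow> nat \<Rightarrow> bool list) \<Rightarrow> (input_symbol \<Rightarrow> nat \<Rightarrow> bool) \<Rightarrow> com" where
  "reduction_prog c K G e f =
     Seq (read_length c) (Seq (power_prog K) (Seq height_prog (Seq formula_prog (Seq setup_prog
    (Seq (Repeat 1 6 (Repeat 3 7 (emit (replicate G True)))) (Seq (emit [False])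
    (Seq (matrix_prog G e) (Seq (values_prog G f) (emit [False])))))))))"

lemma exec_reduction_prog:
  assumes "K > 0" and p: "p = (length x + 1 + c) ^ K"
  shows "\<exists>s'. exec x (2 * p + 1) (reduction_prog c K G e f) (replicate 8 0, 0)
    (enc_fm (nor_fm (2 * p)) @ concat (replicate (2 * p + 1) (block G (2 * p + 1) True)) @ [False] @
     concat (map (\<lambda>l. concat (map (\<lambda>i.
       concat (map (\<lambda>g. row G (e g) (2 * p + 1) l (2 * p + 1 - Suc l) i (2 * p + 1 - Suc i)) [0..<G]))
       [0..<2 * p + 1])) [0..<2 * p + 1]) @
     (concat (replicate (2 * p) (block G (2 * p + 1) False)) @
     concat (map (\<lambda>i. map (\<lambda>g. f (input_at x i) g) [0..<G]) [0..<2 * p + 1])) @ [False]) s'"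
proof -
  define a where "a = length x + 1 + c"
  define n where "n = 2 * p + 1"
  have p': "p = a ^ K" by (simp add: p a_def)
  have ap: "a > 0" by (simp add: a_def)
  \<comment> \<open>A positive exponent makes the base fit under the bound for the power.\<close>
  then have le: "a \<le> p" using assms(1) self_le_power[of a K] by (simp add: p')
  have 1: "exec x n (read_length c) (replicate 8 0, 0) [] ([a, 0, 0, 0, 0, 0, 0, 0], 0)"
    using exec_read_length[of x c n "[0, 0, 0, 0, 0, 0, 0]"] le
    by (simp add: a_def n_def numeral_eq_Suc)
  have 2: "exec x n (power_prog K) ([a, 0, 0, 0, 0, 0, 0, 0], 0) [] ([a, p, 0, 0, 0, 0, 0, 0], 0)"
    unfolding p' by (rule exec_power_prog) (use ap le in \<open>auto simp: n_def p'\<close>)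
  have 3: "exec x n height_prog ([a, p, 0, 0, 0, 0, 0, 0], 0) [] ([a, 0, 2 * p, 0, 0, 0, 0, 0], 0)"
    by (rule exec_height_prog) (simp add: n_def)
  have 4: "exec x n formula_prog ([a, 0, 2 * p, 0, 0, 0, 0, 0], 0) (enc_fm (nor_fm (2 * p)))
      ([a, 0, 2 * p, 0, 2 * p, 0, 0, 0], 0)"
    by (rule exec_formula_prog) (simp add: n_def)
  have 5: "exec x n setup_prog ([a, 0, 2 * p, 0, 2 * p, 0, 0, 0], 0) [] ([a, n, n, n, 0, 0, 0, 0], 0)"
    using exec_setup_prog[of "2 * p" n x a 0] by (simp add: n_def)
  have 6: "exec x n (Repeat 1 6 (Repeat 3 7 (emit (replicate G True)))) ([a, n, n, n, 0, 0, 0, 0], 0)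
      (concat (replicate n (block G n True))) ([a, n, n, n, 0, 0, 0, 0], 0)"
  proof (rule exec_Repeat_const[where n = n])
    fix k assume "k < n"
    have "exec x n (Repeat 3 7 (emit (replicate G True))) ([a, n - Suc k, n, n, 0, 0, Suc k, 0], 0)
        (block G n True) ([a, n - Suc k, n, n, 0, 0, Suc k, 0], 0)"
      unfolding block_def by (rule exec_Repeat_const[where n = n]) (auto intro: exec_emit)
    then show "exec x n (Repeat 3 7 (emit (replicate G True))) ([a, n, n, n, 0, 0, 0, 0][1 := n - Suc k, 6 := Suc k], 0)
        (block G n True) ([a, n, n, n, 0, 0, 0, 0][1 := n - Suc k, 6 := Suc k], 0)"
      by (simp add: list_update_numeral)
  qed auto
  obtain h where 7: "exec x n (values_prog G f) ([a, n, 0, n, n, 0, 0, 0], 0)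
    (concat (replicate (2 * p) (block G n False)) @
     concat (map (\<lambda>i. map (\<lambda>g. f (input_at x i) g) [0..<G]) [0..<n]))
    ([a, n, 0, 0, 0, 0, 0, 0], h)"
    using exec_values_prog[of n n x G f a] by (auto simp: n_def)
  show ?thesis
    unfolding reduction_prog_def n_def[symmetric]
    by (intro exI, rule exec_Seq[OF 1 exec_Seq[OF 2 exec_Seq[OF 3 exec_Seq[OF 4 exec_Seq[OF 5
        exec_Seq[OF 6 exec_Seq[OF exec_emit exec_Seq[OF exec_matrix_prog exec_Seq[OF 7 exec_emit refl] refl]
        refl] refl] refl] refl] refl] refl]]) auto
qed

lemma concat_map_const: "(\<And>k. k \<in> set ks \<Longrightarrow> f k = c) \<Longrightarrow> concat (map f ks) = concat (replicate (length ks) c)"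
  by (metis map_cong map_replicate_const)

section \<open>The code of the model in blocks\<close>

context network
begin

lemma block_eq: "concat (map (\<lambda>i. map (\<lambda>g. b) [0..<G]) [k..<n]) = block G (n - k) b"
  by (simp add: block_def map_replicate_const)

lemma level_eq:
  assumes "\<And>i' g'. P i' g' = b"
  shows "concat (map (\<lambda>i'. concat (map (\<lambda>g'. [P i' g']) [0..<G])) [0..<L]) = block G L b"
  using block_eq[of b 0 L] by (simp add: assms concat_map_singleton)

lemma neighbours_eq:
  assumes "i < L"
  shows "concat (map (\<lambda>i'. concat (map (\<lambda>g'. [edge i g i' g']) [0..<G])) [0..<L]) =
    neighbours G (\<lambda>d. map (E d g) [0..<G]) i (L - Suc i)"
proof -
  let ?f = "\<lambda>i'. map (\<lambda>g'. edge i g i' g') [0..<G]"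
  have far: "concat (map ?f [k..<n]) = block G (n - k) False" if "\<And>i'. k \<le> i' \<Longrightarrow> i' < n \<Longrightarrow> Suc i' < i \<or> Suc i < i'" for k n
  proof -
    have "\<not> edge i g i' g'" if "i' \<in> set [k..<n]" for i' g'
      using \<open>\<And>i'. k \<le> i' \<Longrightarrow> i' < n \<Longrightarrow> Suc i' < i \<or> Suc i < i'\<close>[of i'] that by (auto simp: edge_def)
    then have "map ?f [k..<n] = map (\<lambda>i'. map (\<lambda>g'. False) [0..<G]) [k..<n]"
      by (intro map_cong refl) auto
    then show ?thesis by (simp only: block_eq)
  qed
  have upto: "concat (map ?f [0..<i]) = (if i = 0 then [] else block G (i - 1) False @ map (E 0 g) [0..<G])"
  proof (cases i)
    case (Suc k)
    then show ?thesis using far[of 0 k] by (simp add: edge_def)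
  qed simp
  have after: "concat (map ?f [Suc i..<L]) =
      (if L - Suc i = 0 then [] else map (E 2 g) [0..<G] @ block G (L - Suc i - 1) False)"
  proof (cases "Suc i < L")
    case True
    have "concat (map ?f [Suc i..<L]) = ?f (Suc i) @ block G (L - Suc (Suc i)) False"
      using far[of "Suc (Suc i)" L] True by (simp add: upt_conv_Cons)
    then show ?thesis using True by (simp add: edge_def)
  qed simp
  have "[0..<L] = [0..<i] @ i # [Suc i..<L]"
    using assms upt_add_eq_append[of 0 i "L - i"] by (simp add: upt_conv_Cons)
  from arg_cong[OF this, of "\<lambda>ls. concat (map ?f ls)"]
  have "concat (map ?f [0..<L]) = concat (map ?f [0..<i]) @ ?f i @ concat (map ?f [Suc i..<L])"
    by (simp only: map_append concat_append list.map concat.simps)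
  then show ?thesis
    unfolding upto after neighbours_def by (simp add: edge_def concat_map_singleton)
qed

lemma row_eq:
  assumes "l < L" "i < L"
  shows "all_nodes (\<lambda>l' i' g'. [l + 2 \<le> l' \<or> Suc l = l' \<and> edge i g i' g']) =
    row G (\<lambda>d. map (E d g) [0..<G]) L l (L - Suc l) i (L - Suc i)"
proof -
  let ?f = "\<lambda>l'. concat (map (\<lambda>i'. concat (map (\<lambda>g'. [l + 2 \<le> l' \<or> Suc l = l' \<and> edge i g i' g']) [0..<G])) [0..<L])"
  have upto: "concat (map ?f [0..<Suc l]) = concat (replicate l (block G L False)) @ block G L False"
  proof -
    have "?f l' = block G L False" if "l' \<in> set [0..<Suc l]" for l'
      using that by (intro level_eq) auto
    from concat_map_const[of "[0..<Suc l]" ?f, OF this] show ?thesis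
      by (simp add: concat_replicate_append del: upt_Suc)
  qed
  have after: "concat (map ?f [Suc l..<L]) = (if L - Suc l = 0 then []
      else neighbours G (\<lambda>d. map (E d g) [0..<G]) i (L - Suc i) @ concat (replicate (L - Suc l - 1) (block G L True)))"
  proof (cases "Suc l < L")
    case True
    have "?f (Suc l) = neighbours G (\<lambda>d. map (E d g) [0..<G]) i (L - Suc i)"
      using neighbours_eq[OF assms(2), of g] by simp
    moreover have "concat (map ?f [Suc (Suc l)..<L]) = concat (replicate (L - Suc (Suc l)) (block G L True))"
    proof -
      have "?f l' = block G L True" if "l' \<in> set [Suc (Suc l)..<L]" for l'
        using that by (intro level_eq) auto
      from concat_map_const[of "[Suc (Suc l)..<L]" ?f, OF this] show ?thesis by simp
    qed
    ultimately show ?thesis using True by (simp only: upt_conv_Cons[OF True] list.map concat.simps) simp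
  qed simp
  have "[0..<L] = [0..<Suc l] @ [Suc l..<L]"
    using assms(1) upt_add_eq_append[of 0 "Suc l" "L - Suc l"] by simp
  from arg_cong[OF this, of "\<lambda>ls. concat (map ?f ls)"]
  have "concat (map ?f [0..<L]) = concat (map ?f [0..<Suc l]) @ concat (map ?f [Suc l..<L])"
    by (simp only: map_append concat_append)
  then show ?thesis
    unfolding upto after row_def all_nodes_def by simp
qed

lemma values_eq:
  "all_nodes (\<lambda>l i g. [Suc l = L \<and> ini i g]) =
     concat (replicate (L - 1) (block G L False)) @ concat (map (\<lambda>i. map (ini i) [0..<G]) [0..<L])"
proof -
  let ?f = "\<lambda>l. concat (map (\<lambda>i. concat (map (\<lambda>g. [Suc l = L \<and> ini i g]) [0..<G])) [0..<L])"
  have "[0..<L] = [0..<L - 1] @ [L - 1]"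
    using L upt_Suc_append[of 0 "L - 1"] by simp
  from arg_cong[OF this, of "\<lambda>ls. concat (map ?f ls)"]
  have "concat (map ?f [0..<L]) = concat (map ?f [0..<L - 1]) @ ?f (L - 1)"
    by (simp only: map_append concat_append list.map concat.simps append_Nil2)
  moreover have "concat (map ?f [0..<L - 1]) = concat (replicate (L - 1) (block G L False))"
  proof -
    have "?f l = block G L False" if "l \<in> set [0..<L - 1]" for l
      using that by (intro level_eq) auto
    from concat_map_const[of "[0..<L - 1]" ?f, OF this] show ?thesis by simp
  qed
  ultimately show ?thesis
    using L by (simp add: all_nodes_def concat_map_singleton)
qed

lemma unary_eq: "unary (L * L * G) = concat (replicate L (block G L True)) @ [False]"
proof -
  have "concat (replicate n (replicate k True)) = replicate (n * k) True" for n k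
    by (induction n) (auto simp: replicate_add)
  then show ?thesis by (simp add: block_def unary_def mult.assoc)
qed

lemma enc_model_eq:
  "enc_instance (nor_fm k) model 0 =
     enc_fm (nor_fm k) @ concat (replicate L (block G L True)) @ [False] @
     concat (map (\<lambda>l. concat (map (\<lambda>i.
       concat (map (\<lambda>g. row G (\<lambda>d. map (E d g) [0..<G]) L l (L - Suc l) i (L - Suc i)) [0..<G]))
       [0..<L])) [0..<L]) @
     (concat (replicate (L - 1) (block G L False)) @
     concat (map (\<lambda>i. map (ini i) [0..<G]) [0..<L])) @ [False]"
proof -
  have "all_nodes (\<lambda>l i g. all_nodes (\<lambda>l' i' g'. [l + 2 \<le> l' \<or> Suc l = l' \<and> edge i g i' g'])) =
      all_nodes (\<lambda>l i g. row G (\<lambda>d. map (E d g) [0..<G]) L l (L - Suc l) i (L - Suc i))"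
    by (intro all_nodes_cong row_eq)
  then show ?thesis
    unfolding enc_model values_eq unary_eq by (simp add: all_nodes_def)
qed

end

section \<open>Assembling the reduction\<close>

lemma polynomial_bound:
  assumes "(\<lambda>n. real (t n)) \<in> O(\<lambda>n. real n ^ k)"
  obtains c where "\<And>n. 2 * t n + 2 \<le> (n + 1 + c) ^ Suc k"
proof -
  obtain C where "C > 0" and "eventually (\<lambda>n. norm (real (t n)) \<le> C * norm (real n ^ k)) at_top"
    using landau_o.bigE[OF assms] by blast
  then obtain n0 where n0: "\<And>n. n \<ge> n0 \<Longrightarrow> real (t n) \<le> C * real n ^ k"
    by (auto simp: eventually_at_top_linorder)
  \<comment> \<open>The bound must hold for every \<open>n\<close>: the sum covers the finitely many
    values below \<open>n0\<close>, and beyond them the additional factor in the exponent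
    \<open>Suc k\<close> absorbs the coefficient \<open>C\<close>.\<close>
  define c where "c = 2 * (nat \<lceil>C\<rceil> + (\<Sum>i<n0. t i)) + 2"
  have "2 * t n + 2 \<le> (n + 1 + c) ^ Suc k" for n
  proof (cases "n < n0")
    case True
    then have "t n \<le> (\<Sum>i<n0. t i)" by (intro member_le_sum) auto
    then have "2 * t n + 2 \<le> n + 1 + c" by (simp add: c_def)
    also have "\<dots> \<le> (n + 1 + c) ^ Suc k" by (rule self_le_power) auto
    finally show ?thesis .
  next
    case False
    have "real (t n) \<le> C * real n ^ k" using n0 False by simp
    also have "\<dots> \<le> real (nat \<lceil>C\<rceil>) * real n ^ k" by (intro mult_right_mono real_nat_ceiling_ge) auto
    finally have "t n \<le> nat \<lceil>C\<rceil> * n ^ k" by (simp flip: of_nat_power of_nat_mult)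
    moreover have "n ^ k \<le> (n + 1 + c) ^ k" by (intro power_mono) auto
    ultimately have "t n \<le> nat \<lceil>C\<rceil> * (n + 1 + c) ^ k"
      by (meson le_trans mult_le_mono2)
    moreover have "1 \<le> (n + 1 + c) ^ k" by simp
    ultimately have "2 * t n + 2 \<le> (2 * nat \<lceil>C\<rceil> + 2) * (n + 1 + c) ^ k"
      unfolding add_mult_distrib by linarith
    also have "\<dots> \<le> (n + 1 + c) * (n + 1 + c) ^ k"
      by (intro mult_le_mono1) (simp add: c_def)
    finally show ?thesis by simp
  qed
  then show ?thesis by (rule that)
qed

text \<open>Height \<open>2 * p\<close> simulates \<open>p\<close> steps of two layers each, and
  with \<open>2 * p + 1\<close> positions the corruption from the right border cannot reach position
  \<open>0\<close> in that time.\<close>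

lemma gate_val_0:
  assumes "wf_tm M" "decides_in_time M A t" "2 * t (length x) + 2 \<le> p"
  shows "network.gate_val (2 * p + 1) (length (gates M)) (\<lambda>d g g'. linked M d (gates M ! g) (gates M ! g'))
    (\<lambda>i g. input_gate (input_at x i) (gates M ! g)) (2 * p) 0 0 \<longleftrightarrow> x \<in> A"
proof -
  have "gates M ! 0 = Y Rej" "0 < length (gates M)" using gates[of M] by auto
  from gate_val_evolve[of "2 * p + 1" M 0 p 0 Rej x, OF _ assms(1) _ this(2,1)] evolve_decides[OF assms]
  show ?thesis by simp
qed

theorem theorem3p3:
  shows "P_hard (model_checking FPL_Imp1)"
  unfolding P_hard_def
proof
  fix A assume "A \<in> class_P"
  then obtain M t k where M: "wf_tm M" "decides_in_time M A t" "(\<lambda>n. real (t n)) \<in> O(\<lambda>n. real n ^ k)"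
    by (auto simp: class_P_def)
  obtain c where c: "\<And>n. 2 * t n + 2 \<le> (n + 1 + c) ^ Suc k"
    using polynomial_bound[OF M(3)] by blast
  define p where "p n = (n + 1 + c) ^ Suc k" for n
  \<comment> \<open>One number serves as the count of levels, the count of positions and the bound
    for all counters.\<close>
  define L where "L n = 2 * p n + 1" for n
  let ?G = "length (gates M)"
  let ?E = "\<lambda>d g g'. linked M d (gates M ! g) (gates M ! g')"
  let ?ini = "\<lambda>x i g. input_gate (input_at x i) (gates M ! g)"
  let ?model = "\<lambda>x. network.model (L (length x)) ?G ?E (?ini x)"
  define f where "f x = enc_instance (nor_fm (2 * p (length x))) (?model x) 0" for x
  have net: "network (L (length x)) ?G ?E" for x :: "bool list"
    by (rule network_gates) (simp add: L_def)
  have "x \<in> A \<longleftrightarrow> f x \<in> model_checking FPL_Imp1" for x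
  proof -
    have "f x \<in> model_checking FPL_Imp1 \<longleftrightarrow> sat (?model x) 0 (nor_fm (2 * p (length x)))"
      unfolding f_def
      by (intro enc_instance_in_model_checking_iff network.fpl_instance_model net nor_fm_in_FPL_Imp1)
    also have "\<dots> \<longleftrightarrow> network.gate_val (L (length x)) ?G ?E (?ini x) (2 * p (length x)) 0 0"
      using network.sat_model_nor_fm[OF net, of x "?ini x"] by (simp add: L_def)
    also have "\<dots> \<longleftrightarrow> x \<in> A"
      unfolding L_def by (rule gate_val_0[OF M(1,2)]) (simp only: p_def c)
    finally show ?thesis by simp
  qed
  moreover have "logspace_computable f"
  proof (rule logspace_computableI)
    let ?prog = "reduction_prog c (Suc k) ?G (\<lambda>g d. map (?E d g) [0..<?G]) (\<lambda>s g. input_gate s (gates M ! g))"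
    show "\<exists>s'. exec x (L (length x)) ?prog (replicate 8 0, 0) (f x) s'" for x
      using exec_reduction_prog[of "Suc k" "p (length x)" x c ?G "\<lambda>g d. map (?E d g) [0..<?G]"
          "\<lambda>s g. input_gate s (gates M ! g)"]
        network.enc_model_eq[OF net, of "2 * p (length x)" x "?ini x"]
      by (simp add: f_def L_def p_def)
    show "L n > 0" for n by (simp add: L_def)
    show "(\<lambda>n. ln (real (L n))) \<in> O(\<lambda>n. ln (real n))"
      unfolding L_def p_def by real_asymp
  qed
  ultimately show "A \<le>\<^sub>l\<^sub>o\<^sub>g model_checking FPL_Imp1"
    unfolding logspace_reducible_def by blast
qed

end
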